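(* Assume that at least one of the following holds: (a) $A-iB^*TB\colon\mathbb{V}_h(\Omega)\to\mathbb{V}_h(\Omega)^*$ is invertible; (b) $\operatorname{Im}\{\langle\mathcal{A}_\Gamma(v,q),(\overline v,\overline q)\rangle\}\le0$ for all $v\in H^{1/2}(\Gamma)$ and all $q\in H^{-1/2}(\Gamma)$. For $\boldsymbol\ell\in\mathbb{V}_h(\Omega)^*$ consider, for $(\boldsymbol u,\boldsymbol p)\in\mathbb{V}_h(\Omega)\times\mathbb{V}_h(\Sigma)^*$, the system $$(1)\qquad A\boldsymbol u-B^*\boldsymbol p=\boldsymbol\ell,\qquad -\boldsymbol p+iTB\boldsymbol u=\Pi(\boldsymbol p+iTB\boldsymbol u),$$ and, for $\boldsymbol q\in\mathbb{V}_h(\Sigma)^*$, the equation $$(2)\qquad (\mathrm{Id}+\Pi S)\boldsymbol q=-2i\,\Pi TB(A-iB^*TB)^\dagger\boldsymbol\ell.$$ If $(\boldsymbol u,\boldsymbol p)\in\mathbb{V}_h(\Omega)\times\mathbb{V}_h(\Sigma)^*$ satisfies (1) for some $\boldsymbol\ell\in\operatorname{Im}(A)+\operatorname{Im}(B^* )$, then $\boldsymbol q=\boldsymbol p-iTB\boldsymbol u$ solves (2). Conversely, if $\boldsymbol q$ satisfies (2), then the pair $(\boldsymbol u,\boldsymbol p)\in\mathbb{V}_h(\Omega)\times\mathbb{V}_h(\Sigma)^*$ given by $\boldsymbol u=(A-iB^*TB)^\dagger(B^*\boldsymbol q+\boldsymbol\ell)$ and $\boldsymbol p=(\boldsymbol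 q-\Pi(\boldsymbol q))/2$ solves (1).
   Context: Conventions. All vector spaces are complex; duality pairings $\langle\cdot,\cdot\rangle$ are bilinear (no complex conjugation) and act componentwise on Cartesian products. For a bounded linear $L\colon H\to V$, the adjoint $L^*\colon V^*\to H^*$ is defined by $\langle L^*p,u\rangle=\langle p,Lu\rangle$ (no conjugation), and $\overline{L}$ by $\overline{L}(\overline u)=\overline{L(u)}$. $\operatorname{Im}(L)$ denotes the range of a linear map $L$, and $\operatorname{Im}\{z\}$ the imaginary part of a complex number $z$. Setting. $\Omega\subset\mathbb{R}^d$ ($d=2,3$) is a bounded polyhedral open set, $\Gamma=\partial\Omega$; $H^{1/2}(\Gamma)$ is the space of traces of $H^1(\Omega)$ and $H^{-1/2}(\Gamma)$ its dual. $\kappa\colon\mathbb{R}^d\to\mathbb{C}$ is measurable and essentially bounded, with $\operatorname{Im}\{\kappa(x)^2\}\ge0$ for all $x\in\Omega$, and equal to a constant $\tilde k>0$ outside $\Omega$. $\mathcal{A}_\Gamma\colon H^{1/2}(\Gamma)\times H^{-1/2}(\Gamma)\to H^{-1/2}(\Gamma)\times H^{1/2}(\Gamma)$ is a given bounded linear operator. Discretization. $\Omega$ is covered by a regular simplicial mesh; $V_h(\Omega)\subset H^1(\Omega)$ is the space of continuous $\mathbb{P}_k$-Lagrange finite element functions; for a subset $\Theta\subset\overline\Omega$ that is a union of mesh cells or of mesh faces, $V_h(\Theta)=\{v|_\Theta: v\in V_h(\Omega)\}$. $Q_h(\Gamma)\subset H^{-1/2}(\Gamma)$ is a finite-dimensional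 subspace. Domain decomposition. $\overline\Omega=\overline\Omega_1\cup\dots\cup\overline\Omega_J$ with pairwise disjoint polyhedral open sets $\Omega_j$ that are unions of mesh cells, $\Gamma_j=\partial\Omega_j$, $\Sigma=\Gamma\cup\Gamma_1\cup\dots\cup\Gamma_J$. Set $V_h^{b}(\Gamma)=V_h(\Gamma)\times Q_h(\Gamma)$, $\mathbb{V}_h(\Omega)=V_h^{b}(\Gamma)\times V_h(\Omega_1)\times\dots\times V_h(\Omega_J)$, $\mathbb{V}_h(\Sigma)=V_h(\Gamma)\times V_h(\Gamma_1)\times\dots\times V_h(\Gamma_J)$. The trace operator $B\colon\mathbb{V}_h(\Omega)\to\mathbb{V}_h(\Sigma)$ is $B((v,q),u_1,\dots,u_J)=(v,u_1|_{\Gamma_1},\dots,u_J|_{\Gamma_J})$. The restriction operator $R\colon V_h(\Sigma)\to\mathbb{V}_h(\Sigma)$ is $R(u)=(u|_\Gamma,u|_{\Gamma_1},\dots,u|_{\Gamma_J})$. $A=\operatorname{diag}(A_\Gamma,A_{\Omega_1},\dots,A_{\Omega_J})\colon\mathbb{V}_h(\Omega)\to\mathbb{V}_h(\Omega)^*$, where $\langle A_\Gamma(u),v\rangle=\langle\mathcal{A}_\Gamma(u),v\rangle$ for $u,v\in V_h^b(\Gamma)$ and $\langle A_{\Omega_j}(u),v\rangle=\int_{\Omega_j}(\nabla u\cdot\nabla v-\kappa^2uv)\,dx$ for $u,v\in V_h(\Omega_j)$. Impedance, exchange and scattering operators. $T\colon\mathbb{V}_h(\Sigma)\to\mathbb{V}_h(\Sigma)^*$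 is any linear operator with $T^*=T=\overline T$ and $\langle T(u),\overline u\rangle>0$ for all $u\neq0$. $\Pi=2TR(R^*TR)^{-1}R^*-\mathrm{Id}\colon\mathbb{V}_h(\Sigma)^*\to\mathbb{V}_h(\Sigma)^*$. $S=\mathrm{Id}+2iTB(A-iB^*TB)^{\dagger}B^*\colon\mathbb{V}_h(\Sigma)^*\to\mathbb{V}_h(\Sigma)^*$, where $\dagger$ denotes the Moore-Penrose pseudo-inverse with respect to a fixed Hilbert norm on $\mathbb{V}_h(\Omega)$ (e.g. the product of the $H^{1/2}(\Gamma)\times H^{-1/2}(\Gamma)$ and $H^1(\Omega_j)$ norms) and the dual norm on $\mathbb{V}_h(\Omega)^*$.
   Formalization: In alternative (b), Q_h(Γ) is also assumed closed under complex conjugation, and ℓ ∈ Im(A)+Im(B* ) is required in the converse direction too; without either assumption the claim as stated fails. *)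

theory Defs
  imports "HOL-Analysis.Analysis" "HOL-Library.Function_Algebras"
begin

section \<open>Complex linear algebra on subspaces\<close>

class complex_vector = ab_group_add +
  fixes scaleC :: "complex \<Rightarrow> 'a \<Rightarrow> 'a" (infixr "*\<^sub>C" 75)
  assumes scaleC_add_right: "a *\<^sub>C (x + y) = a *\<^sub>C x + a *\<^sub>C y"
    and scaleC_add_left: "(a + b) *\<^sub>C x = a *\<^sub>C x + b *\<^sub>C x"
    and scaleC_scaleC: "a *\<^sub>C (b *\<^sub>C x) = (a * b) *\<^sub>C x"
    and scaleC_one: "1 *\<^sub>C x = x"

instantiation complex :: complex_vector
begin
definition scaleC_complex :: "complex \<Rightarrow> complex \<Rightarrow> complex" where
  "scaleC_complex a x = a * x"
instance
  by standard (simp_all add: scaleC_complex_def algebra_simps)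
end

instantiation "fun" :: (type, complex_vector) complex_vector
begin
definition scaleC_fun :: "complex \<Rightarrow> ('a \<Rightarrow> 'b) \<Rightarrow> 'a \<Rightarrow> 'b" where
  "scaleC_fun a f = (\<lambda>x. a *\<^sub>C f x)"
instance
  by standard
    (simp_all add: scaleC_fun_def fun_eq_iff scaleC_add_right scaleC_add_left
      scaleC_scaleC scaleC_one)
end

instantiation prod :: (complex_vector, complex_vector) complex_vector
begin
definition scaleC_prod :: "complex \<Rightarrow> 'a \<times> 'b \<Rightarrow> 'a \<times> 'b" where
  "scaleC_prod a z = (a *\<^sub>C fst z, a *\<^sub>C snd z)"
instance
  by standard
    (simp_all add: scaleC_prod_def prod_eq_iff scaleC_add_right scaleC_add_left
      scaleC_scaleC scaleC_one)
end

global_interpretation complex_vector: vector_space "scaleC :: complex \<Rightarrow> 'a \<Rightarrow> 'a::complex_vector"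
  by unfold_locales
    (simp_all add: scaleC_add_right scaleC_add_left scaleC_scaleC scaleC_one)

definition clinear_on :: "'a::complex_vector set \<Rightarrow> 'b::complex_vector set \<Rightarrow> ('a \<Rightarrow> 'b) \<Rightarrow> bool" where
  "clinear_on V W f \<longleftrightarrow> f ` V \<subseteq> W \<and>
     (\<forall>x\<in>V. \<forall>y\<in>V. f (x + y) = f x + f y) \<and> (\<forall>a. \<forall>x\<in>V. f (a *\<^sub>C x) = a *\<^sub>C f x)"

text \<open>Functionals on a set \<open>V\<close> are normalised to vanish off \<open>V\<close>, so that equality of functionals
  on \<open>V\<close> is equality in HOL.\<close>

definition cdual :: "'a::complex_vector set \<Rightarrow> ('a \<Rightarrow> complex) set" where
  "cdual V = {\<phi>. clinear_on V UNIV \<phi> \<and> (\<forall>x. x \<notin> V \<longrightarrow> \<phi> x = 0)}"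

definition adjoint_on :: "'a::complex_vector set \<Rightarrow> ('a \<Rightarrow> 'b) \<Rightarrow> ('b \<Rightarrow> complex) \<Rightarrow> 'a \<Rightarrow> complex" where
  "adjoint_on V L p = (\<lambda>u. if u \<in> V then p (L u) else 0)"

definition bidual_embed :: "'a::complex_vector set \<Rightarrow> 'a \<Rightarrow> ('a \<Rightarrow> complex) \<Rightarrow> complex" where
  "bidual_embed V u = (\<lambda>\<phi>. if \<phi> \<in> cdual V then \<phi> u else 0)"

text \<open>\<open>conj_dual C\<close> is the conjugation of functionals induced by a conjugation \<open>C\<close> of vectors.\<close>

definition conj_dual :: "('a \<Rightarrow> 'a) \<Rightarrow> ('a \<Rightarrow> complex) \<Rightarrow> 'a \<Rightarrow> complex" where
  "conj_dual C \<phi> = (\<lambda>u. cnj (\<phi> (C u)))"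

definition conj_op :: "('a \<Rightarrow> 'a) \<Rightarrow> ('a \<Rightarrow> 'a \<Rightarrow> complex) \<Rightarrow> 'a \<Rightarrow> 'a \<Rightarrow> complex" where
  "conj_op C T = (\<lambda>u. conj_dual C (T (C u)))"

definition inner_product_on :: "'a::complex_vector set \<Rightarrow> ('a \<Rightarrow> 'a \<Rightarrow> complex) \<Rightarrow> bool" where
  "inner_product_on V ip \<longleftrightarrow>
     (\<forall>y\<in>V. clinear_on V UNIV (\<lambda>x. ip x y)) \<and>
     (\<forall>x\<in>V. \<forall>y\<in>V. ip y x = cnj (ip x y)) \<and>
     (\<forall>x\<in>V. x \<noteq> 0 \<longrightarrow> Re (ip x x) > 0)"

definition ip_norm :: "('a \<Rightarrow> 'a \<Rightarrow> complex) \<Rightarrow> 'a \<Rightarrow> real" where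
  "ip_norm ip u = sqrt (Re (ip u u))"

definition dual_norm :: "'a set \<Rightarrow> ('a \<Rightarrow> real) \<Rightarrow> ('a \<Rightarrow> complex) \<Rightarrow> real" where
  "dual_norm V N \<phi> = (SUP u\<in>{u\<in>V. N u \<le> 1}. cmod (\<phi> u))"

text \<open>Moore--Penrose pseudo-inverse of \<open>L : V \<rightarrow> V*\<close>, for the norm of \<open>ip\<close> on \<open>V\<close> and the dual norm
  on \<open>V*\<close>: the least-squares solution of minimal norm.\<close>

definition least_squares ::
    "'a set \<Rightarrow> ('a \<Rightarrow> 'a \<Rightarrow> complex) \<Rightarrow> ('a \<Rightarrow> 'a \<Rightarrow> complex) \<Rightarrow> ('a \<Rightarrow> complex) \<Rightarrow> 'a set" where
  "least_squares V ip L l =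
     {u\<in>V. \<forall>w\<in>V. dual_norm V (ip_norm ip) (L u - l) \<le> dual_norm V (ip_norm ip) (L w - l)}"

definition pseudo_inverse ::
    "'a set \<Rightarrow> ('a \<Rightarrow> 'a \<Rightarrow> complex) \<Rightarrow> ('a \<Rightarrow> 'a \<Rightarrow> complex) \<Rightarrow> ('a \<Rightarrow> complex) \<Rightarrow> 'a" where
  "pseudo_inverse V ip L l =
     (THE u. u \<in> least_squares V ip L l \<and>
             (\<forall>w\<in>least_squares V ip L l. ip_norm ip u \<le> ip_norm ip w))"


section \<open>Sobolev spaces\<close>

type_synonym 'n field = "real ^ 'n \<Rightarrow> complex"

definition conj_fun :: "('a \<Rightarrow> complex) \<Rightarrow> 'a \<Rightarrow> complex" where
  "conj_fun f = (\<lambda>x. cnj (f x))"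

definition partial :: "'n \<Rightarrow> (real ^ 'n \<Rightarrow> 'b::real_normed_vector) \<Rightarrow> real ^ 'n \<Rightarrow> 'b" where
  "partial i f x = vector_derivative (\<lambda>t. f (x + t *\<^sub>R axis i 1)) (at 0)"

definition smooth :: "(real ^ 'n \<Rightarrow> real) \<Rightarrow> bool" where
  "smooth f \<longleftrightarrow> (\<forall>is. continuous_on UNIV (foldr partial is f) \<and>
     (\<forall>i x. (\<lambda>t. foldr partial is f (x + t *\<^sub>R axis i 1)) differentiable (at 0)))"

definition test_function :: "(real ^ 'n) set \<Rightarrow> (real ^ 'n \<Rightarrow> real) \<Rightarrow> bool" where
  "test_function \<Omega> \<phi> \<longleftrightarrow> smooth \<phi> \<and> (\<exists>K. compact K \<and> K \<subseteq> \<Omega> \<and> (\<forall>x. x \<notin> K \<longrightarrow> \<phi> x = 0))"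

definition square_integrable_on ::
    "(real ^ 'n \<Rightarrow> 'b::{real_normed_vector,second_countable_topology}) \<Rightarrow> (real ^ 'n) set \<Rightarrow> bool"
    (infix "square'_integrable'_on" 50) where
  "f square_integrable_on \<Omega> \<longleftrightarrow>
     set_borel_measurable lebesgue \<Omega> f \<and> set_integrable lebesgue \<Omega> (\<lambda>x. (norm (f x))\<^sup>2)"

definition weak_gradient :: "(real ^ 'n) set \<Rightarrow> 'n field \<Rightarrow> (real ^ 'n \<Rightarrow> complex ^ 'n) \<Rightarrow> bool" where
  "weak_gradient \<Omega> u g \<longleftrightarrow> g square_integrable_on \<Omega> \<and>
     (\<forall>\<phi> i. test_function \<Omega> \<phi> \<longrightarrow>
        set_lebesgue_integral lebesgue \<Omega> (\<lambda>x. u x * of_real (partial i \<phi> x)) =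
        - set_lebesgue_integral lebesgue \<Omega> (\<lambda>x. g x $ i * of_real (\<phi> x)))"

definition H1 :: "(real ^ 'n) set \<Rightarrow> 'n field set" where
  "H1 \<Omega> = {u. u square_integrable_on \<Omega> \<and> (\<exists>g. weak_gradient \<Omega> u g)}"

text \<open>Weak gradients are unique almost everywhere, so the infimum is over a single number.\<close>

definition H1_norm :: "(real ^ 'n) set \<Rightarrow> 'n field \<Rightarrow> real" where
  "H1_norm \<Omega> u = (INF g\<in>{g. weak_gradient \<Omega> u g}.
     sqrt (set_lebesgue_integral lebesgue \<Omega> (\<lambda>x. (norm (u x))\<^sup>2 + (norm (g x))\<^sup>2)))"

text \<open>Surface measure on the boundary: the Hausdorff measure of dimension one less than that of
  the space. Its normalisation is immaterial here, since only null sets and \<open>L\<^sup>2\<close> convergence on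
  the boundary are used.\<close>

definition hausdorff_outer :: "nat \<Rightarrow> 'a::metric_space set \<Rightarrow> ennreal" where
  "hausdorff_outer s X = (SUP \<delta>\<in>{0::real<..}.
     INF U\<in>{U :: nat \<Rightarrow> 'a set. X \<subseteq> (\<Union>i. U i) \<and> (\<forall>i. bounded (U i) \<and> diameter (U i) \<le> \<delta>)}.
       \<Sum>i. ennreal (diameter (U i) ^ s))"

definition surface_measure :: "(real ^ 'n) measure" where
  "surface_measure = measure_of UNIV (sets borel) (hausdorff_outer (CARD('n) - 1))"

text \<open>The trace map is the continuous extension of \<open>v \<mapsto> v|\<^sub>\<Gamma>\<close> from \<open>H\<^sup>1(\<Omega>) \<inter> C(closure \<Omega>)\<close>. Functions on
  a subset of space are represented by their extension by zero.\<close>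

definition has_trace :: "(real ^ 'n) set \<Rightarrow> 'n field \<Rightarrow> 'n field \<Rightarrow> bool" where
  "has_trace \<Omega> u g \<longleftrightarrow> g \<in> borel_measurable borel \<and> (\<forall>x. x \<notin> frontier \<Omega> \<longrightarrow> g x = 0) \<and>
     (\<exists>v. (\<forall>m::nat. v m \<in> H1 \<Omega> \<and> continuous_on (closure \<Omega>) (v m)) \<and>
        (\<lambda>m. H1_norm \<Omega> (v m - u)) \<longlonglongrightarrow> 0 \<and>
        (\<lambda>m. \<integral>\<^sup>+x\<in>frontier \<Omega>. ennreal ((norm (v m x - g x))\<^sup>2) \<partial>surface_measure) \<longlonglongrightarrow> 0)"

text \<open>Elements of \<open>H\<^sup>1\<^sup>/\<^sup>2(\<Gamma>)\<close>, with \<open>\<Gamma>\<close> the boundary of \<open>\<Omega>\<close>, are represented by functions rather than by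
  classes of functions modulo surface null sets; \<open>H12_norm\<close>, the quotient norm, is correspondingly
  a seminorm. Bounded functionals only see the classes.\<close>

definition H12 :: "(real ^ 'n) set \<Rightarrow> 'n field set" where
  "H12 \<Omega> = {g. \<exists>u\<in>H1 \<Omega>. has_trace \<Omega> u g}"

definition H12_norm :: "(real ^ 'n) set \<Rightarrow> 'n field \<Rightarrow> real" where
  "H12_norm \<Omega> g = (INF u\<in>{u\<in>H1 \<Omega>. has_trace \<Omega> u g}. H1_norm \<Omega> u)"

definition Hm12 :: "(real ^ 'n) set \<Rightarrow> ('n field \<Rightarrow> complex) set" where
  "Hm12 \<Omega> = {q\<in>cdual (H12 \<Omega>). \<exists>C. \<forall>v\<in>H12 \<Omega>. cmod (q v) \<le> C * H12_norm \<Omega> v}"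

definition Hm12_norm :: "(real ^ 'n) set \<Rightarrow> ('n field \<Rightarrow> complex) \<Rightarrow> real" where
  "Hm12_norm \<Omega> = dual_norm (H12 \<Omega>) (H12_norm \<Omega>)"

text \<open>Linearity on representatives is no restriction: an operator between the quotient spaces lifts
  to a linear one by a linear choice of representatives.\<close>

definition bounded_boundary_op ::
    "(real ^ 'n) set \<Rightarrow> ('n field \<times> ('n field \<Rightarrow> complex) \<Rightarrow> ('n field \<Rightarrow> complex) \<times> 'n field) \<Rightarrow> bool" where
  "bounded_boundary_op \<Omega> \<A> \<longleftrightarrow>
     clinear_on (H12 \<Omega> \<times> Hm12 \<Omega>) (Hm12 \<Omega> \<times> H12 \<Omega>) \<A> \<and>
     (\<exists>C. \<forall>v\<in>H12 \<Omega>. \<forall>q\<in>Hm12 \<Omega>.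
        Hm12_norm \<Omega> (fst (\<A> (v, q))) + H12_norm \<Omega> (snd (\<A> (v, q)))
          \<le> C * (H12_norm \<Omega> v + Hm12_norm \<Omega> q))"

definition boundary_pairing ::
    "('n field \<Rightarrow> complex) \<times> 'n field \<Rightarrow> 'n field \<times> ('n field \<Rightarrow> complex) \<Rightarrow> complex" where
  "boundary_pairing f z = fst f (fst z) + snd z (snd f)"


section \<open>Meshes and finite element spaces\<close>

text \<open>Polyhedral open sets are the interiors of finite unions of convex polytopes; they are bounded
  and have no cracks.\<close>

definition polyhedral_open :: "(real ^ 'n) set \<Rightarrow> bool" where
  "polyhedral_open \<Omega> \<longleftrightarrow> (\<exists>F. finite F \<and> (\<forall>P\<in>F. polytope P) \<and> \<Omega> = interior (\<Union>F))"

definition simplicial_mesh :: "(real ^ 'n) set \<Rightarrow> (real ^ 'n) set set \<Rightarrow> bool" where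
  "simplicial_mesh \<Omega> \<T> \<longleftrightarrow>
     triangulation \<T> \<and> (\<forall>K\<in>\<T>. int CARD('n) simplex K) \<and> \<Union>\<T> = closure \<Omega>"

definition domain_decomposition ::
    "(real ^ 'n) set \<Rightarrow> (real ^ 'n) set set \<Rightarrow> ('j \<Rightarrow> (real ^ 'n) set) \<Rightarrow> bool" where
  "domain_decomposition \<Omega> \<T> \<Omega>s \<longleftrightarrow>
     closure \<Omega> = (\<Union>j. closure (\<Omega>s j)) \<and> disjoint_family \<Omega>s \<and>
     (\<forall>j. polyhedral_open (\<Omega>s j) \<and> (\<exists>\<T>'\<subseteq>\<T>. closure (\<Omega>s j) = \<Union>\<T>'))"

definition skeleton :: "(real ^ 'n) set \<Rightarrow> ('j \<Rightarrow> (real ^ 'n) set) \<Rightarrow> (real ^ 'n) set" where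
  "skeleton \<Omega> \<Omega>s = frontier \<Omega> \<union> (\<Union>j. frontier (\<Omega>s j))"

definition restr :: "'a set \<Rightarrow> ('a \<Rightarrow> complex) \<Rightarrow> 'a \<Rightarrow> complex" where
  "restr \<Theta> v = (\<lambda>x. if x \<in> \<Theta> then v x else 0)"

definition poly_on :: "nat \<Rightarrow> (real ^ 'n) set \<Rightarrow> 'n field \<Rightarrow> bool" where
  "poly_on k K v \<longleftrightarrow> (\<exists>c. \<forall>x\<in>K.
     v x = (\<Sum>\<alpha>\<in>{\<alpha> :: 'n \<Rightarrow> nat. (\<Sum>i\<in>UNIV. \<alpha> i) \<le> k}. c \<alpha> * of_real (\<Prod>i\<in>UNIV. x $ i ^ \<alpha> i)))"

definition fe_space :: "(real ^ 'n) set \<Rightarrow> (real ^ 'n) set set \<Rightarrow> nat \<Rightarrow> 'n field set" where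
  "fe_space \<Omega> \<T> k = {v\<in>H1 \<Omega>. continuous_on (closure \<Omega>) v \<and>
     (\<forall>x. x \<notin> closure \<Omega> \<longrightarrow> v x = 0) \<and> (\<forall>K\<in>\<T>. poly_on k K v)}"

definition fe_restr ::
    "(real ^ 'n) set \<Rightarrow> (real ^ 'n) set set \<Rightarrow> nat \<Rightarrow> (real ^ 'n) set \<Rightarrow> 'n field set" where
  "fe_restr \<Omega> \<T> k \<Theta> = restr \<Theta> ` fe_space \<Omega> \<T> k"

text \<open>The local spaces live on the closed subdomains (unions of closed cells), so that they have
  pointwise boundary values.\<close>

definition broken_space ::
    "(real ^ 'n) set \<Rightarrow> (real ^ 'n) set set \<Rightarrow> nat \<Rightarrow> ('n field \<Rightarrow> complex) set \<Rightarrow>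
     ('j \<Rightarrow> (real ^ 'n) set) \<Rightarrow> (('n field \<times> ('n field \<Rightarrow> complex)) \<times> ('j \<Rightarrow> 'n field)) set" where
  "broken_space \<Omega> \<T> k Qh \<Omega>s =
     (fe_restr \<Omega> \<T> k (frontier \<Omega>) \<times> Qh) \<times> {u. \<forall>j. u j \<in> fe_restr \<Omega> \<T> k (closure (\<Omega>s j))}"

definition multitrace_space ::
    "(real ^ 'n) set \<Rightarrow> (real ^ 'n) set set \<Rightarrow> nat \<Rightarrow> ('j \<Rightarrow> (real ^ 'n) set) \<Rightarrow>
     ('n field \<times> ('j \<Rightarrow> 'n field)) set" where
  "multitrace_space \<Omega> \<T> k \<Omega>s =
     fe_restr \<Omega> \<T> k (frontier \<Omega>) \<times> {u. \<forall>j. u j \<in> fe_restr \<Omega> \<T> k (frontier (\<Omega>s j))}"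

definition conj_multitrace :: "'n field \<times> ('j \<Rightarrow> 'n field) \<Rightarrow> 'n field \<times> ('j \<Rightarrow> 'n field)" where
  "conj_multitrace w = (conj_fun (fst w), \<lambda>j. conj_fun (snd w j))"


section \<open>Operators\<close>

definition trace_op ::
    "('j \<Rightarrow> (real ^ 'n) set) \<Rightarrow> ('n field \<times> ('n field \<Rightarrow> complex)) \<times> ('j \<Rightarrow> 'n field) \<Rightarrow>
     'n field \<times> ('j \<Rightarrow> 'n field)" where
  "trace_op \<Omega>s u = (fst (fst u), \<lambda>j. restr (frontier (\<Omega>s j)) (snd u j))"

definition restr_op ::
    "(real ^ 'n) set \<Rightarrow> ('j \<Rightarrow> (real ^ 'n) set) \<Rightarrow> 'n field \<Rightarrow> 'n field \<times> ('j \<Rightarrow> 'n field)" where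
  "restr_op \<Omega> \<Omega>s u = (restr (frontier \<Omega>) u, \<lambda>j. restr (frontier (\<Omega>s j)) u)"

text \<open>Finite element functions are polynomial in each cell, so the pointwise gradient exists off
  the cell boundaries, which form a null set, and represents the weak gradient.\<close>

definition helmholtz_form :: "(real ^ 'n \<Rightarrow> complex) \<Rightarrow> (real ^ 'n) set \<Rightarrow> 'n field \<Rightarrow> 'n field \<Rightarrow> complex" where
  "helmholtz_form \<kappa> D u v = set_lebesgue_integral lebesgue D
     (\<lambda>x. (\<Sum>i\<in>UNIV. partial i u x * partial i v x) - (\<kappa> x)\<^sup>2 * u x * v x)"

text \<open>The block diagonal operator \<open>diag(A\<^sub>\<Gamma>, A\<^sub>\<Omega>\<^sub>1, \<dots>, A\<^sub>\<Omega>\<^sub>J)\<close> on the space \<open>V\<close>.\<close>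

definition diag_op ::
    "(('n field \<times> ('n field \<Rightarrow> complex)) \<times> ('j::finite \<Rightarrow> 'n field)) set \<Rightarrow>
     ('n field \<times> ('n field \<Rightarrow> complex) \<Rightarrow> ('n field \<Rightarrow> complex) \<times> 'n field) \<Rightarrow>
     (real ^ 'n \<Rightarrow> complex) \<Rightarrow> ('j \<Rightarrow> (real ^ 'n) set) \<Rightarrow>
     ('n field \<times> ('n field \<Rightarrow> complex)) \<times> ('j \<Rightarrow> 'n field) \<Rightarrow>
     ('n field \<times> ('n field \<Rightarrow> complex)) \<times> ('j \<Rightarrow> 'n field) \<Rightarrow> complex" where
  "diag_op V \<A> \<kappa> \<Omega>s u = (\<lambda>v. if v \<in> V then
       boundary_pairing (\<A> (fst u)) (fst v) + (\<Sum>j\<in>UNIV. helmholtz_form \<kappa> (\<Omega>s j) (snd u j) (snd v j))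
     else 0)"

text \<open>\<open>T* = T\<close>, \<open>conj T = T\<close> and positivity on \<open>W\<close>, where \<open>C\<close> is the conjugation of \<open>W\<close>.\<close>

definition impedance_op ::
    "'a::complex_vector set \<Rightarrow> ('a \<Rightarrow> 'a) \<Rightarrow> ('a \<Rightarrow> 'a \<Rightarrow> complex) \<Rightarrow> bool" where
  "impedance_op W C T \<longleftrightarrow> clinear_on W (cdual W) T \<and>
     (\<forall>u\<in>W. adjoint_on W T (bidual_embed W u) = T u) \<and>
     (\<forall>u\<in>W. conj_op C T u = T u) \<and>
     (\<forall>u\<in>W. u \<noteq> 0 \<longrightarrow> Im (T u (C u)) = 0 \<and> Re (T u (C u)) > 0)"

text \<open>\<open>\<Pi> = 2TR(R*TR)\<^sup>-\<^sup>1R* - Id\<close>, with \<open>R\<close> defined on \<open>X\<close>.\<close>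

definition exchange_op ::
    "'x::complex_vector set \<Rightarrow> ('x \<Rightarrow> 'a) \<Rightarrow> ('a \<Rightarrow> 'a \<Rightarrow> complex) \<Rightarrow> ('a \<Rightarrow> complex) \<Rightarrow> 'a \<Rightarrow> complex" where
  "exchange_op X R T p =
     2 *\<^sub>C T (R (inv_into X (\<lambda>u. adjoint_on X R (T (R u))) (adjoint_on X R p))) - p"

text \<open>\<open>A - iB*TB\<close> on \<open>V\<close>.\<close>

definition impedance_problem_op ::
    "'v::complex_vector set \<Rightarrow> ('v \<Rightarrow> 'v \<Rightarrow> complex) \<Rightarrow> ('v \<Rightarrow> 'a) \<Rightarrow> ('a \<Rightarrow> 'a \<Rightarrow> complex) \<Rightarrow>
     'v \<Rightarrow> 'v \<Rightarrow> complex" where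
  "impedance_problem_op V A B T u = A u - \<i> *\<^sub>C adjoint_on V B (T (B u))"

definition scattering_op ::
    "'v::complex_vector set \<Rightarrow> ('v \<Rightarrow> 'v \<Rightarrow> complex) \<Rightarrow> ('v \<Rightarrow> 'v \<Rightarrow> complex) \<Rightarrow> ('v \<Rightarrow> 'a) \<Rightarrow>
     ('a \<Rightarrow> 'a \<Rightarrow> complex) \<Rightarrow> ('a \<Rightarrow> complex) \<Rightarrow> 'a \<Rightarrow> complex" where
  "scattering_op V ip A B T q =
     q + (2 * \<i>) *\<^sub>C T (B (pseudo_inverse V ip (impedance_problem_op V A B T) (adjoint_on V B q)))"

end

theory Submission
  imports Defs
begin

text \<open>Write \<open>M = A - i B\<^sup>* T B\<close>. Everything rests on two facts: \<open>M u = 0\<close> forces \<open>B u = 0\<close>, and the range of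
  \<open>M\<close> is \<open>Im A + Im B\<^sup>*\<close>. If \<open>M\<close> is invertible they are trivial. In the dissipative case, the imaginary part of
  \<open>\<langle>M u, conj u\<rangle>\<close> is at most \<open>- \<langle>T B u, conj (B u)\<rangle>\<close>, which gives the first; the same argument applied
  to the transpose shows that a vector annihilated by the range of \<open>M\<close> is annihilated by \<open>Im A\<close> and
  \<open>Im B\<^sup>*\<close>, which in finite dimension gives the second. On its range \<open>M\<close> is inverted by the pseudo-inverse
  up to its kernel, which \<open>B\<close> does not see, and the equivalence becomes algebra with the
  involution \<open>\<Pi>\<close>.\<close>

section \<open>Linear maps, functionals and finite spans\<close>

text \<open>The pseudo-inverse is a definite description over minimal-norm least-squares solutions,
  so its linearity is not at hand. The hypothesis on \<open>l\<close> and the range identity make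
  every evaluation take place on the range of \<open>M\<close>, where it is a right inverse. Since
  the kernel of \<open>M\<close> lies in that of \<open>B\<close>, all preimages of \<open>y\<close>
  under \<open>M\<close> give the same value of \<open>T (B u)\<close>, and
  \<open>T (B (Mp y))\<close> may be computed from whichever preimage is at hand.

  The pairings are bilinear, so positivity must be tested against a conjugated vector; each energy
  argument therefore needs a space stable under conjugation. \<open>A\<close> is not symmetric in
  general. The transposed argument still works because a vector annihilated by the range can be
  tested against its own conjugate, which produces the same energy as in the kernel argument.

  As \<open>Pex\<close> is a linear involution, the second line of (1) says exactly that it fixes
  \<open>T (B u)\<close> and reverses the sign of \<open>p\<close>; the converse half recovers these
  two relations.\<close>

lemmas subspace_add = complex_vector.subspace_add
  and subspace_diff = complex_vector.subspace_diff
  and subspace_scale = complex_vector.subspace_scale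
  and subspace_0 = complex_vector.subspace_0

lemma scaleC_minus_one [simp]: "(- 1) *\<^sub>C x = - x" for x :: "'a::complex_vector"
  using complex_vector.scale_minus_left[of 1 x] by (simp add: scaleC_one)

lemma scaleC_two: "2 *\<^sub>C x = x + x" for x :: "'a::complex_vector"
  using scaleC_add_left[of 1 1 x] by (simp add: scaleC_one)

lemma scaleC_fun_apply [simp]: "(a *\<^sub>C f) x = a *\<^sub>C f x"
  by (simp add: scaleC_fun_def)

lemma scaleC_complex_eq [simp]: "a *\<^sub>C z = a * z" for z :: complex
  by (simp add: scaleC_complex_def)

lemma fst_scaleC [simp]: "fst (a *\<^sub>C z) = a *\<^sub>C fst z"
  and snd_scaleC [simp]: "snd (a *\<^sub>C z) = a *\<^sub>C snd z"
  by (simp_all add: scaleC_prod_def)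

lemma sum_fun_apply: "(\<Sum>i\<in>I. f i) x = (\<Sum>i\<in>I. f i x)"
  by (induction I rule: infinite_finite_induct) auto

lemma clinear_onI:
  assumes "\<And>x. x \<in> V \<Longrightarrow> f x \<in> W"
    and "\<And>x y. x \<in> V \<Longrightarrow> y \<in> V \<Longrightarrow> f (x + y) = f x + f y"
    and "\<And>a x. x \<in> V \<Longrightarrow> f (a *\<^sub>C x) = a *\<^sub>C f x"
  shows "clinear_on V W f"
  using assms unfolding clinear_on_def by blast

lemma clinear_on_mem: "clinear_on V W f \<Longrightarrow> x \<in> V \<Longrightarrow> f x \<in> W"
  and clinear_on_add: "clinear_on V W f \<Longrightarrow> x \<in> V \<Longrightarrow> y \<in> V \<Longrightarrow> f (x + y) = f x + f y"
  and clinear_on_scale: "clinear_on V W f \<Longrightarrow> x \<in> V \<Longrightarrow> f (a *\<^sub>C x) = a *\<^sub>C f x"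
  unfolding clinear_on_def by blast+

lemma clinear_on_minus: "clinear_on V W f \<Longrightarrow> x \<in> V \<Longrightarrow> f (- x) = - f x"
  using clinear_on_scale[of V W f x "-1"] by simp

lemma clinear_on_diff:
  assumes "clinear_on V W f" "complex_vector.subspace V" "x \<in> V" "y \<in> V"
  shows "f (x - y) = f x - f y"
  using clinear_on_add[OF assms(1) assms(3) complex_vector.subspace_neg[OF assms(2,4)]]
    clinear_on_minus[OF assms(1,4)] by simp

lemma clinear_on_zero: "clinear_on V W f \<Longrightarrow> complex_vector.subspace V \<Longrightarrow> f 0 = 0"
  using clinear_on_diff[of V W f 0 0] complex_vector.subspace_0 by force

lemma clinear_on_sum:
  assumes f: "clinear_on V W f" and V: "complex_vector.subspace V"
    and g: "\<And>i. i \<in> I \<Longrightarrow> g i \<in> V"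
  shows "f (\<Sum>i\<in>I. g i) = (\<Sum>i\<in>I. f (g i))"
  using g
proof (induction I rule: infinite_finite_induct)
  case (insert i I)
  have "(\<Sum>i\<in>I. g i) \<in> V" using insert.prems by (intro complex_vector.subspace_sum V) auto
  then show ?case using insert clinear_on_add[OF f, of "g i" "\<Sum>i\<in>I. g i"] by simp
qed (use clinear_on_zero[OF f V] in simp_all)

lemma clinear_on_compose:
  "clinear_on U V g \<Longrightarrow> clinear_on V W f \<Longrightarrow> clinear_on U W (\<lambda>x. f (g x))"
  unfolding clinear_on_def by (auto simp: image_subset_iff)

lemma clinear_on_subset: "clinear_on V W f \<Longrightarrow> U \<subseteq> V \<Longrightarrow> clinear_on U W f"
  unfolding clinear_on_def by blast

section \<open>Functionals that vanish off their domain, and adjoints\<close>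

lemma cdualI:
  assumes "\<And>x y. x \<in> V \<Longrightarrow> y \<in> V \<Longrightarrow> \<phi> (x + y) = \<phi> x + \<phi> y"
    and "\<And>a x. x \<in> V \<Longrightarrow> \<phi> (a *\<^sub>C x) = a * \<phi> x"
    and "\<And>x. x \<notin> V \<Longrightarrow> \<phi> x = 0"
  shows "\<phi> \<in> cdual V"
  using assms unfolding cdual_def by (auto intro!: clinear_onI)

lemma cdual_clinear: "\<phi> \<in> cdual V \<Longrightarrow> clinear_on V UNIV \<phi>"
  and cdual_off: "\<phi> \<in> cdual V \<Longrightarrow> x \<notin> V \<Longrightarrow> \<phi> x = 0"
  unfolding cdual_def by blast+

lemma cdual_add: "\<phi> \<in> cdual V \<Longrightarrow> x \<in> V \<Longrightarrow> y \<in> V \<Longrightarrow> \<phi> (x + y) = \<phi> x + \<phi> y"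
  and cdual_scale: "\<phi> \<in> cdual V \<Longrightarrow> x \<in> V \<Longrightarrow> \<phi> (a *\<^sub>C x) = a * \<phi> x"
  using clinear_on_add[OF cdual_clinear] clinear_on_scale[OF cdual_clinear] by auto

lemma cdual_eqI:
  assumes "\<phi> \<in> cdual V" "\<psi> \<in> cdual V" "\<And>x. x \<in> V \<Longrightarrow> \<phi> x = \<psi> x"
  shows "\<phi> = \<psi>"
  using assms cdual_off by (metis ext)

lemma subspace_cdual: "complex_vector.subspace (cdual V)"
  by (intro complex_vector.subspaceI cdualI)
    (auto simp: cdual_add cdual_scale cdual_off algebra_simps)

lemma adjoint_clinear:
  assumes L: "clinear_on V W L"
    and V: "complex_vector.subspace V"
  shows "clinear_on (cdual W) (cdual V) (adjoint_on V L)"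
proof (rule clinear_onI)
  fix p assume p: "p \<in> cdual W"
  show "adjoint_on V L p \<in> cdual V"
    using V clinear_on_mem[OF L] p
    by (intro cdualI)
      (auto simp: adjoint_on_def clinear_on_add[OF L] clinear_on_scale[OF L] cdual_add cdual_scale
        subspace_add subspace_scale)
qed (auto simp: adjoint_on_def fun_eq_iff)

lemma subspace_kernel:
  assumes "clinear_on V W f" "complex_vector.subspace V"
  shows "complex_vector.subspace {x\<in>V. f x = 0}"
  using assms
  by (intro complex_vector.subspaceI)
    (auto simp: clinear_on_zero clinear_on_add clinear_on_scale subspace_0 subspace_add subspace_scale)

section \<open>Finite-dimensional subspaces of function spaces\<close>

definition finitely_spanned :: "'a::complex_vector set \<Rightarrow> bool" where
  "finitely_spanned V \<longleftrightarrow> (\<exists>F. finite F \<and> V = complex_vector.span F)"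

lemma finitely_spanned_subspace: "finitely_spanned V \<Longrightarrow> complex_vector.subspace V"
  unfolding finitely_spanned_def by auto

text \<open>The generators \<open>F\<close> may lie outside \<open>V\<close>, so they are replaced
  by a maximal independent subset of \<open>V\<close>, which the exchange lemma bounds by the size
  of \<open>F\<close>. The spaces are sets inside infinite-dimensional function types, so finite
  dimension has to be a property of a set.\<close>

lemma finitely_spannedI:
  assumes V: "complex_vector.subspace V" and F: "finite F" "V \<subseteq> complex_vector.span F"
  shows "finitely_spanned V"
proof -
  obtain E where E: "E \<subseteq> V" "complex_vector.independent E" "V \<subseteq> complex_vector.span E"
    using complex_vector.maximal_independent_subset by blast
  have "finite E"
    using complex_vector.independent_span_bound[OF F(1) E(2)] E(1) F(2) by blast
  moreover have "V = complex_vector.span E"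
    using complex_vector.span_minimal[OF E(1) V] E(3) by blast
  ultimately show ?thesis unfolding finitely_spanned_def by blast
qed

lemma finitely_spanned_subset:
  assumes "finitely_spanned V" "complex_vector.subspace U" "U \<subseteq> V"
  shows "finitely_spanned U"
  using assms finitely_spannedI unfolding finitely_spanned_def by metis

lemma subspace_image:
  assumes f: "clinear_on V W f" and V: "complex_vector.subspace V"
  shows "complex_vector.subspace (f ` V)"
proof (rule complex_vector.subspaceI)
  show "0 \<in> f ` V" using clinear_on_zero[OF f V] subspace_0[OF V] by force
next
  fix x y assume "x \<in> f ` V" "y \<in> f ` V"
  then obtain a b where "x = f a" "y = f b" "a \<in> V" "b \<in> V" by blast
  then show "x + y \<in> f ` V"
    using clinear_on_add[OF f, of a b] subspace_add[OF V, of a b] by (metis image_eqI)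
next
  fix c x assume "x \<in> f ` V"
  then obtain a where "x = f a" "a \<in> V" by blast
  then show "c *\<^sub>C x \<in> f ` V"
    using clinear_on_scale[OF f, of a c] subspace_scale[OF V, of a c] by (metis image_eqI)
qed

lemma finitely_spanned_image:
  assumes f: "clinear_on V W f" and V: "finitely_spanned V"
  shows "finitely_spanned (f ` V)"
proof -
  obtain F where F: "finite F" "V = complex_vector.span F" using V finitely_spanned_def by blast
  have Vs: "complex_vector.subspace V" using finitely_spanned_subspace[OF V] .
  have FV: "F \<subseteq> V" using F complex_vector.span_superset by blast
  have "f v \<in> complex_vector.span (f ` F)" if "v \<in> V" for v
  proof -
    have "v \<in> range (\<lambda>u. \<Sum>x\<in>F. u x *\<^sub>C x)"
      using that F complex_vector.span_finite[OF F(1)] by simp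
    then obtain u where u: "v = (\<Sum>x\<in>F. u x *\<^sub>C x)" by blast
    have "f v = (\<Sum>x\<in>F. u x *\<^sub>C f x)"
      unfolding u using FV clinear_on_scale[OF f]
      by (subst clinear_on_sum[OF f Vs]) (auto intro!: subspace_scale[OF Vs] sum.cong)
    then show ?thesis
      by (metis (no_types, lifting) complex_vector.span_sum complex_vector.span_scale
        complex_vector.span_base image_eqI)
  qed
  then show ?thesis
    using F(1) by (intro finitely_spannedI[where F = "f ` F"] subspace_image[OF f Vs]) auto
qed

lemma finitely_spanned_Times:
  fixes U :: "'a::complex_vector set" and V :: "'b::complex_vector set"
  assumes "finitely_spanned U" "finitely_spanned V"
  shows "finitely_spanned (U \<times> V)"
proof -
  obtain F where F: "finite F" "U = complex_vector.span F" using assms finitely_spanned_def by blast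
  obtain G where G: "finite G" "V = complex_vector.span G" using assms finitely_spanned_def by blast
  note Us = finitely_spanned_subspace[OF assms(1)] and Vs = finitely_spanned_subspace[OF assms(2)]
  let ?H = "(\<lambda>x. (x, 0)) ` F \<union> (\<lambda>y. (0, y)) ` G"
  have "(x, 0) \<in> complex_vector.span ?H" if "x \<in> U" for x
    using that unfolding F(2)
  proof (induction rule: complex_vector.span_induct_alt)
    case base
    show ?case using complex_vector.span_zero[of ?H] by (simp add: zero_prod_def)
  next
    case (step c x y)
    have "(c *\<^sub>C x + y, 0) = c *\<^sub>C (x, 0) + (y, 0::'b)" by (simp add: scaleC_prod_def)
    moreover have "(x, 0) \<in> complex_vector.span ?H"
      using step by (intro complex_vector.span_base) auto
    ultimately show ?case
      using step complex_vector.span_add complex_vector.span_scale by metis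
  qed
  moreover have "(0, x) \<in> complex_vector.span ?H" if "x \<in> V" for x
    using that unfolding G(2)
  proof (induction rule: complex_vector.span_induct_alt)
    case base
    show ?case using complex_vector.span_zero[of ?H] by (simp add: zero_prod_def)
  next
    case (step c x y)
    have "(0, c *\<^sub>C x + y) = c *\<^sub>C (0::'a, x) + (0, y)" by (simp add: scaleC_prod_def)
    moreover have "(0, x) \<in> complex_vector.span ?H"
      using step by (intro complex_vector.span_base) auto
    ultimately show ?case
      using step complex_vector.span_add complex_vector.span_scale by metis
  qed
  ultimately have "U \<times> V \<subseteq> complex_vector.span ?H"
    using complex_vector.span_add[of "(x, 0)" ?H "(0, y)" for x y] by force
  moreover have "complex_vector.subspace (U \<times> V)"
    by (intro complex_vector.subspaceI)
      (auto simp: scaleC_prod_def zero_prod_def subspace_0[OF Us] subspace_0[OF Vs] subspace_add[OF Us] subspace_add[OF Vs]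
        subspace_scale[OF Us] subspace_scale[OF Vs])
  ultimately show ?thesis using F(1) G(1) by (intro finitely_spannedI[where F = ?H]) auto
qed

lemma finitely_spanned_Pi:
  fixes V :: "'j::finite \<Rightarrow> 'a::complex_vector set"
  assumes "\<And>j. finitely_spanned (V j)"
  shows "finitely_spanned {u. \<forall>j. u j \<in> V j}"
proof -
  have "\<forall>j. \<exists>F. finite F \<and> V j = complex_vector.span F"
    using assms unfolding finitely_spanned_def by blast
  then obtain F where "\<forall>j. finite (F j) \<and> V j = complex_vector.span (F j)"
    by (rule choice[elim_format]) blast
  then have F: "\<And>j. finite (F j)" "\<And>j. V j = complex_vector.span (F j)" by blast+
  \<comment> \<open>\<open>?e j x\<close> has \<open>x\<close> in slot \<open>j\<close> and zero
    elsewhere; with finitely many slots every family is a finite sum of such vectors.\<close>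
  let ?e = "\<lambda>j x i. if i = j then x else (0::'a)"
  let ?H = "\<Union>j. ?e j ` F j"
  have e: "?e j x \<in> complex_vector.span ?H" if "x \<in> V j" for j x
    using that unfolding F(2)
  proof (induction rule: complex_vector.span_induct_alt)
    case base
    have eq: "?e j 0 = 0" by (auto simp: fun_eq_iff)
    show ?case unfolding eq by (rule complex_vector.span_zero)
  next
    case (step c x y)
    have eq: "?e j (c *\<^sub>C x + y) = c *\<^sub>C ?e j x + ?e j y" by (auto simp: fun_eq_iff)
    have "?e j x \<in> complex_vector.span ?H"
      using step by (intro complex_vector.span_base) auto
    then show ?case
      unfolding eq by (intro complex_vector.span_add complex_vector.span_scale step)
  qed
  have "u \<in> complex_vector.span ?H" if u: "\<And>j. u j \<in> V j" for u
  proof -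
    have eq: "(\<Sum>j\<in>UNIV. ?e j (u j)) = u"
      by (auto simp: fun_eq_iff sum_fun_apply)
    have "(\<Sum>j\<in>UNIV. ?e j (u j)) \<in> complex_vector.span ?H"
      by (intro complex_vector.span_sum e u)
    then show ?thesis unfolding eq .
  qed
  moreover have "complex_vector.subspace {u. \<forall>j. u j \<in> V j}"
    using finitely_spanned_subspace[OF assms]
    by (intro complex_vector.subspaceI) (auto simp: subspace_0 subspace_add subspace_scale)
  ultimately show ?thesis using F(1) by (intro finitely_spannedI[where F = ?H]) auto
qed

text \<open>Replaces dimension counting in the identification of ranges of operators into a dual space.\<close>

lemma functional_in_span_of_finite_family:
  fixes \<phi> :: "'i \<Rightarrow> 'a::complex_vector \<Rightarrow> complex"
  assumes "finite I" "complex_vector.subspace V"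
    and "\<And>i. i \<in> I \<Longrightarrow> clinear_on V UNIV (\<phi> i)" "clinear_on V UNIV \<psi>"
    and "\<And>v. v \<in> V \<Longrightarrow> (\<And>i. i \<in> I \<Longrightarrow> \<phi> i v = 0) \<Longrightarrow> \<psi> v = 0"
  shows "\<exists>c. \<forall>v\<in>V. \<psi> v = (\<Sum>i\<in>I. c i * \<phi> i v)"
  using assms
proof (induction I arbitrary: V rule: finite_induct)
  case (insert i I)
  \<comment> \<open>Inside the kernel of \<open>\<phi> i\<close> the common zeros of the remaining
    functionals are zeros of \<open>\<psi>\<close>, so the induction hypothesis applies
    there.\<close>
  let ?K = "{v\<in>V. \<phi> i v = 0}"
  have \<phi>: "clinear_on V UNIV (\<phi> i)" using insert.prems by blast
  note V = insert.prems(1) and \<psi> = insert.prems(3)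
  have "\<exists>c. \<forall>v\<in>?K. \<psi> v = (\<Sum>i\<in>I. c i * \<phi> i v)"
  proof (rule insert.IH)
    show "complex_vector.subspace ?K" by (rule subspace_kernel[OF \<phi> V])
    show "clinear_on ?K UNIV (\<phi> j)" if "j \<in> I" for j
      using insert.prems(2)[of j] that by (auto intro: clinear_on_subset)
    show "clinear_on ?K UNIV \<psi>" using \<psi> by (auto intro: clinear_on_subset)
  qed (use insert.prems(4) in auto)
  then obtain c where c: "\<And>v. v \<in> ?K \<Longrightarrow> \<psi> v = (\<Sum>i\<in>I. c i * \<phi> i v)" by blast
  show ?case
  proof (cases "\<exists>z\<in>V. \<phi> i z \<noteq> 0")
    case True
    then obtain z where z: "z \<in> V" "\<phi> i z \<noteq> 0" by blast
    \<comment> \<open>The new coefficient is forced by equality at the single vector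
      \<open>z\<close>; a multiple of \<open>z\<close> moves any \<open>v\<close> into
      \<open>?K\<close>, where equality is known.\<close>
    let ?d = "(\<psi> z - (\<Sum>i\<in>I. c i * \<phi> i z)) / \<phi> i z"
    have "\<psi> v = ?d * \<phi> i v + (\<Sum>i\<in>I. c i * \<phi> i v)" if v: "v \<in> V" for v
    proof -
      let ?a = "\<phi> i v / \<phi> i z"
      have a: "?a *\<^sub>C z \<in> V" using subspace_scale[OF V z(1)] .
      have lin: "f (v - ?a *\<^sub>C z) = f v - ?a * f z" if "clinear_on V UNIV f" for f :: "'a \<Rightarrow> complex"
        using clinear_on_diff[OF that V v a] clinear_on_scale[OF that z(1)] by simp
      have "v - ?a *\<^sub>C z \<in> ?K" using lin[OF \<phi>] z(2) subspace_diff[OF V v a] by simp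
      from c[OF this] have "\<psi> v - ?a * \<psi> z = (\<Sum>i\<in>I. c i * \<phi> i (v - ?a *\<^sub>C z))"
        using lin[OF \<psi>] by simp
      also have "\<dots> = (\<Sum>j\<in>I. c j * \<phi> j v - ?a * (c j * \<phi> j z))"
      proof (rule sum.cong)
        fix j assume "j \<in> I"
        then have "\<phi> j (v - ?a *\<^sub>C z) = \<phi> j v - ?a * \<phi> j z"
          using lin insert.prems(2)[of j] by auto
        then show "c j * \<phi> j (v - ?a *\<^sub>C z) = c j * \<phi> j v - ?a * (c j * \<phi> j z)"
          by (simp only: right_diff_distrib mult.left_commute)
      qed simp
      also have "\<dots> = (\<Sum>i\<in>I. c i * \<phi> i v) - ?a * (\<Sum>i\<in>I. c i * \<phi> i z)"
        by (simp add: sum_subtractf sum_distrib_left)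
      finally show ?thesis using z(2) by (simp add: field_simps)
    qed
    moreover have "(\<Sum>j\<in>I. (c(i := ?d)) j * \<phi> j v) = (\<Sum>j\<in>I. c j * \<phi> j v)" for v
      using insert.hyps by (intro sum.cong) auto
    ultimately show ?thesis
      using insert.hyps by (intro exI[of _ "c(i := ?d)"]) simp
  next
    case False
    then have "\<psi> v = (\<Sum>j\<in>insert i I. c j * \<phi> j v)" if "v \<in> V" for v
      using c[of v] that insert.hyps by simp
    then show ?thesis by blast
  qed
qed auto

text \<open>The functionals \<open>M x\<close>, for \<open>x\<close> in a finite generating set of
  \<open>U\<close>, span the range. Their common zeros are the vectors annihilated by the range, so
  \<open>y\<close> vanishes there and is a combination of them.\<close>

lemma range_eq_annihilator:
  assumes U: "finitely_spanned U" and V: "complex_vector.subspace V"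
    and M: "clinear_on U (cdual V) M" and y: "y \<in> cdual V"
    and ann: "\<And>v. v \<in> V \<Longrightarrow> (\<And>u. u \<in> U \<Longrightarrow> M u v = 0) \<Longrightarrow> y v = 0"
  shows "y \<in> M ` U"
proof -
  obtain F where F: "finite F" "U = complex_vector.span F" using U finitely_spanned_def by blast
  have FU: "F \<subseteq> U" using F complex_vector.span_superset by blast
  note Us = finitely_spanned_subspace[OF U]
  have M_comb: "M (\<Sum>x\<in>F. c x *\<^sub>C x) = (\<Sum>x\<in>F. c x *\<^sub>C M x)" for c
    using FU clinear_on_scale[OF M] by (subst clinear_on_sum[OF M Us]) (auto intro!: subspace_scale[OF Us] sum.cong)
  have "\<exists>c. \<forall>v\<in>V. y v = (\<Sum>x\<in>F. c x * M x v)"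
  proof (rule functional_in_span_of_finite_family[OF F(1) V])
    show "clinear_on V UNIV (M x)" if "x \<in> F" for x
      using that FU clinear_on_mem[OF M] cdual_clinear by blast
    show "clinear_on V UNIV y" using cdual_clinear[OF y] .
    fix v assume v: "v \<in> V" "\<And>x. x \<in> F \<Longrightarrow> M x v = 0"
    have "M u v = 0" if "u \<in> U" for u
    proof -
      have "u \<in> range (\<lambda>u. \<Sum>x\<in>F. u x *\<^sub>C x)"
        using that F complex_vector.span_finite[OF F(1)] by simp
      then show ?thesis using M_comb v(2) by (auto simp: sum_fun_apply)
    qed
    then show "y v = 0" using ann v(1) by blast
  qed
  then obtain c where c: "\<And>v. v \<in> V \<Longrightarrow> y v = (\<Sum>x\<in>F. c x * M x v)" by blast
  have u: "(\<Sum>x\<in>F. c x *\<^sub>C x) \<in> U"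
    using FU by (auto intro!: complex_vector.subspace_sum subspace_scale Us)
  have "y = M (\<Sum>x\<in>F. c x *\<^sub>C x)"
    using c by (intro cdual_eqI[OF y clinear_on_mem[OF M u]]) (simp add: M_comb sum_fun_apply)
  then show ?thesis using u by blast
qed

section \<open>The Moore--Penrose pseudo-inverse on the range\<close>

lemma inner_product_on_facts:
  assumes "inner_product_on V ip" "complex_vector.subspace V" "x \<in> V" "y \<in> V" "z \<in> V"
  shows "ip (x + y) z = ip x z + ip y z" "ip (x - y) z = ip x z - ip y z"
    "ip (a *\<^sub>C x) z = a * ip x z" "ip y x = cnj (ip x y)"
    "ip z (x + y) = ip z x + ip z y" "ip z (x - y) = ip z x - ip z y"
    "ip z (a *\<^sub>C x) = cnj a * ip z x" "Im (ip x x) = 0" "Re (ip x x) \<ge> 0"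
    "Re (ip x x) = 0 \<Longrightarrow> x = 0" "ip 0 z = 0" "ip z 0 = 0"
proof -
  have lin: "clinear_on V UNIV (\<lambda>x. ip x y)" if "y \<in> V" for y
    using assms(1)[unfolded inner_product_on_def, THEN conjunct1] that by blast
  have sym: "ip y x = cnj (ip x y)" if "x \<in> V" "y \<in> V" for x y
    using assms(1)[unfolded inner_product_on_def, THEN conjunct2, THEN conjunct1] that by blast
  have pos: "Re (ip x x) > 0" if "x \<in> V" "x \<noteq> 0" for x
    using assms(1)[unfolded inner_product_on_def, THEN conjunct2, THEN conjunct2] that by blast
  note V = assms(2) and x = assms(3) and y = assms(4) and z = assms(5)
  note linz = lin[OF z]
  show add: "ip (x + y) z = ip x z + ip y z" using clinear_on_add[OF linz x y] .
  show diff: "ip (x - y) z = ip x z - ip y z" using clinear_on_diff[OF linz V x y] .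
  show scale: "ip (a *\<^sub>C x) z = a * ip x z" using clinear_on_scale[OF linz x] by simp
  show zero: "ip 0 z = 0" using clinear_on_zero[OF linz V] .
  show "ip y x = cnj (ip x y)" using sym[OF x y] .
  show "ip z (x + y) = ip z x + ip z y"
    unfolding sym[OF subspace_add[OF V x y] z] sym[OF x z] sym[OF y z] add by simp
  show "ip z (x - y) = ip z x - ip z y"
    unfolding sym[OF subspace_diff[OF V x y] z] sym[OF x z] sym[OF y z] diff by simp
  show "ip z (a *\<^sub>C x) = cnj a * ip z x"
    unfolding sym[OF subspace_scale[OF V x] z] sym[OF x z] scale by simp
  show "ip z 0 = 0"
    unfolding sym[OF subspace_0[OF V] z] zero by simp
  show "Im (ip x x) = 0" using sym[of x x] assms(3) by (metis cnj.sel(2) neg_equal_zero)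
  show "Re (ip x x) \<ge> 0"
  proof (cases "x = 0")
    case True
    then show ?thesis using clinear_on_zero[OF lin[OF x] V] by simp
  qed (use pos[OF x] in simp)
  show "Re (ip x x) = 0 \<Longrightarrow> x = 0" using pos[of x] assms(3) by force
qed

lemma ip_norm_pythagoras:
  assumes ip: "inner_product_on V ip" and V: "complex_vector.subspace V" and "x \<in> V" "y \<in> V"
    and "ip x y = 0"
  shows "(ip_norm ip (x + y))\<^sup>2 = (ip_norm ip x)\<^sup>2 + (ip_norm ip y)\<^sup>2"
proof -
  note facts = inner_product_on_facts[OF ip V]
  have xy: "x + y \<in> V" using subspace_add[OF V assms(3,4)] .
  have "ip y x = 0" using facts(4)[OF assms(3,4,3)] assms(5) by simp
  then have "ip (x + y) (x + y) = ip x x + ip y y"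
    using facts(1)[OF assms(3,4) xy] facts(5)[OF assms(3,4,3)] facts(5)[OF assms(3,4,4)] assms(5) by simp
  then show ?thesis
    using facts(9)[OF assms(3,3,3)] facts(9)[OF assms(4,4,4)] by (simp add: ip_norm_def)
qed

text \<open>Gram-Schmidt, one generator at a time: \<open>e\<close> is the part of the new generator
  orthogonal to the old span, and the old projection of \<open>x\<close> is corrected along
  \<open>e\<close>. The induction hypothesis is used for \<open>x\<close> and for \<open>a\<close>,
  hence the arbitrary \<open>x\<close>.\<close>

lemma exists_orthogonal_projection:
  assumes ip: "inner_product_on V ip" and V: "complex_vector.subspace V" and "finite F" "F \<subseteq> V"
    and "x \<in> V"
  shows "\<exists>k\<in>complex_vector.span F. \<forall>h\<in>complex_vector.span F. ip (x - k) h = 0"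
  using assms(3-5)
proof (induction F arbitrary: x rule: finite_induct)
  case empty
  then show ?case using inner_product_on_facts(12)[OF ip V empty(2) empty(2) empty(2)] by auto
next
  case (insert a F)
  note facts = inner_product_on_facts[OF ip V]
  have sp: "complex_vector.span F \<subseteq> V"
    using insert.prems complex_vector.span_minimal[OF _ V] by blast
  have sub: "complex_vector.span F \<subseteq> complex_vector.span (insert a F)"
    by (intro complex_vector.span_mono) auto
  obtain k where k: "k \<in> complex_vector.span F" "\<And>h. h \<in> complex_vector.span F \<Longrightarrow> ip (x - k) h = 0"
    using insert.IH[of x] insert.prems by blast
  obtain b where b: "b \<in> complex_vector.span F" "\<And>h. h \<in> complex_vector.span F \<Longrightarrow> ip (a - b) h = 0"
    using insert.IH[of a] insert.prems by blast
  have kV: "k \<in> V" and bV: "b \<in> V" and aV: "a \<in> V" using k b sp insert.prems by auto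
  define e where "e = a - b"
  have eV: "e \<in> V" using subspace_diff[OF V aV bV] e_def by blast
  have es: "e \<in> complex_vector.span (insert a F)"
    unfolding e_def using b(1) sub
    by (intro complex_vector.span_diff) (auto intro: complex_vector.span_base)
  \<comment> \<open>If \<open>a\<close> already lies in the old span, then \<open>e = 0\<close>, and
    division by zero gives \<open>?c = 0\<close>: no correction is made.\<close>
  let ?c = "ip (x - k) e / ip e e"
  have xk: "x - k \<in> V" using subspace_diff[OF V] kV insert.prems by blast
  have ce: "?c *\<^sub>C e \<in> V" using subspace_scale[OF V eV] .
  have orth_e: "ip (x - k - ?c *\<^sub>C e) e = 0"
  proof (cases "e = 0")
    case True
    then show ?thesis using facts(12)[OF eV eV subspace_diff[OF V xk ce]] by simp
  next
    case False
    then have "ip e e \<noteq> 0" using facts(10)[OF eV eV eV] by force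
    then show ?thesis using facts(2)[OF xk ce eV] facts(3)[OF eV eV eV] by simp
  qed
  have "ip (x - (k + ?c *\<^sub>C e)) h = 0" if h': "h \<in> complex_vector.span (insert a F)" for h
  proof -
    obtain c where c: "h - c *\<^sub>C a \<in> complex_vector.span F"
      using h' complex_vector.span_breakdown_eq by blast
    have h: "h = (h - c *\<^sub>C a + c *\<^sub>C b) + c *\<^sub>C e"
      unfolding e_def by (simp add: complex_vector.scale_right_diff_distrib)
    define g where "g = h - c *\<^sub>C a + c *\<^sub>C b"
    have g: "g \<in> complex_vector.span F"
      unfolding g_def using b(1) c by (auto intro!: complex_vector.span_add complex_vector.span_scale)
    have gV: "g \<in> V" using g sp by blast
    have 1: "ip (x - k - ?c *\<^sub>C e) g = 0"
      using facts(2)[OF xk ce gV] facts(3)[OF eV eV gV] k(2)[OF g] b(2)[OF g] by (simp add: e_def)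
    have z: "x - k - ?c *\<^sub>C e \<in> V" using subspace_diff[OF V xk ce] .
    have "ip (x - k - ?c *\<^sub>C e) h = ip (x - k - ?c *\<^sub>C e) (g + c *\<^sub>C e)"
      by (subst h) (simp add: g_def)
    also have "\<dots> = 0"
      using facts(5)[OF gV subspace_scale[OF V eV] z] facts(7)[OF eV eV z] 1 orth_e by simp
    finally show ?thesis by (simp add: diff_diff_eq)
  qed
  moreover have "k + ?c *\<^sub>C e \<in> complex_vector.span (insert a F)"
    using k(1) es sub by (auto intro!: complex_vector.span_add complex_vector.span_scale)
  ultimately show ?case by blast
qed

text \<open>By Pythagoras the projection \<open>c *\<^sub>C y\<close> of \<open>x\<close> onto
  \<open>y\<close> is no longer than \<open>x\<close>; writing out its length gives the
  inequality.\<close>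

lemma ip_norm_Cauchy_Schwarz:
  assumes ip: "inner_product_on V ip" and V: "complex_vector.subspace V" and x: "x \<in> V" and y: "y \<in> V"
  shows "cmod (ip x y) \<le> ip_norm ip x * ip_norm ip y"
proof (cases "y = 0")
  case True
  then show ?thesis
    using inner_product_on_facts(9,12)[OF ip V x x x] inner_product_on_facts(12)[OF ip V y y y]
    by (simp add: ip_norm_def)
next
  case False
  note facts = inner_product_on_facts[OF ip V]
  have yy: "ip y y = of_real (Re (ip y y))" using facts(8)[OF y y y] by (simp add: complex_eq_iff)
  have pos: "Re (ip y y) > 0" using facts(9,10)[OF y y y] False by fastforce
  then have nz: "ip y y \<noteq> 0" by force
  define c where "c = ip x y / ip y y"
  have cy: "c *\<^sub>C y \<in> V" using subspace_scale[OF V y] .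
  have xc: "x - c *\<^sub>C y \<in> V" using subspace_diff[OF V x cy] .
  have o: "ip (x - c *\<^sub>C y) (c *\<^sub>C y) = 0"
  proof -
    have "ip (x - c *\<^sub>C y) y = 0"
      using facts(2)[OF x cy y] facts(3)[OF y y y] nz by (simp add: c_def)
    then show ?thesis using facts(7)[OF y y xc] by simp
  qed
  have "(ip_norm ip (c *\<^sub>C y))\<^sup>2 \<le> (ip_norm ip (x - c *\<^sub>C y + c *\<^sub>C y))\<^sup>2"
    unfolding ip_norm_pythagoras[OF ip V xc cy o] by simp
  then have "(ip_norm ip (c *\<^sub>C y))\<^sup>2 \<le> (ip_norm ip x)\<^sup>2" by simp
  moreover have "(ip_norm ip (c *\<^sub>C y))\<^sup>2 = (cmod c)\<^sup>2 * Re (ip y y)"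
  proof -
    have "ip (c *\<^sub>C y) (c *\<^sub>C y) = (c * cnj c) * ip y y"
      using facts(3)[OF y y cy] facts(7)[OF y y y] by simp
    then have "Re (ip (c *\<^sub>C y) (c *\<^sub>C y)) = (cmod c)\<^sup>2 * Re (ip y y)"
      by (simp add: complex_norm_square[symmetric] Re_complex_of_real del: of_real_power)
    then show ?thesis using facts(9)[OF cy cy cy] by (simp add: ip_norm_def)
  qed
  moreover have "(cmod c)\<^sup>2 * Re (ip y y) = (cmod (ip x y))\<^sup>2 / Re (ip y y)"
  proof -
    have "cmod c = cmod (ip x y) / Re (ip y y)"
      using pos arg_cong[OF yy, of cmod] unfolding c_def by (simp add: norm_divide)
    then show ?thesis using pos by (simp add: power2_eq_square)
  qed
  moreover have "(ip_norm ip x)\<^sup>2 = Re (ip x x)" using facts(9)[OF x x x] by (simp add: ip_norm_def)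
  ultimately have "(cmod (ip x y))\<^sup>2 \<le> Re (ip x x) * Re (ip y y)"
    using pos by (simp add: divide_le_eq)
  then have "cmod (ip x y) \<le> sqrt (Re (ip x x) * Re (ip y y))" by (rule real_le_rsqrt)
  then show ?thesis by (simp add: ip_norm_def real_sqrt_mult)
qed

text \<open>Riesz representation: a nonzero functional is a multiple of the inner product with a
  vector \<open>e\<close> orthogonal to its kernel, so Cauchy-Schwarz bounds it. The bound is what
  gives meaning to \<open>dual_norm\<close>, a supremum of real numbers.\<close>

lemma cdual_bounded:
  assumes ip: "inner_product_on V ip" and V: "finitely_spanned V" and \<phi>: "\<phi> \<in> cdual V"
  obtains C where "\<And>u. u \<in> V \<Longrightarrow> cmod (\<phi> u) \<le> C * ip_norm ip u"
proof (cases "\<exists>z\<in>V. \<phi> z \<noteq> 0")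
  case True
  note Vs = finitely_spanned_subspace[OF V]
  note facts = inner_product_on_facts[OF ip Vs] and lin = cdual_clinear[OF \<phi>]
  obtain z where z: "z \<in> V" "\<phi> z \<noteq> 0" using True by blast
  let ?K = "{v\<in>V. \<phi> v = 0}"
  have "finitely_spanned ?K"
    using finitely_spanned_subset[OF V subspace_kernel[OF lin Vs]] by auto
  then obtain F where F: "finite F" "?K = complex_vector.span F"
    unfolding finitely_spanned_def by blast
  then have FV: "F \<subseteq> V" using complex_vector.span_superset[of F] by auto
  obtain k where k: "k \<in> ?K" "\<And>h. h \<in> ?K \<Longrightarrow> ip (z - k) h = 0"
    using exists_orthogonal_projection[OF ip Vs F(1) FV z(1)] F(2) by auto
  define e where "e = z - k"
  have eV: "e \<in> V" using subspace_diff[OF Vs z(1)] k(1) e_def by blast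
  have \<phi>e: "\<phi> e \<noteq> 0" using clinear_on_diff[OF lin Vs z(1), of k] k(1) z(2) e_def by simp
  then have "e \<noteq> 0" using clinear_on_zero[OF lin Vs] by auto
  then have ee: "Re (ip e e) > 0" using facts(9,10)[OF eV eV eV] by fastforce
  \<comment> \<open>The Riesz identity: \<open>u\<close> minus a multiple of \<open>e\<close> lies
    in the kernel, to which \<open>e\<close> is orthogonal.\<close>
  have "\<phi> u * ip e e = \<phi> e * ip u e" if u: "u \<in> V" for u
  proof -
    let ?a = "\<phi> u / \<phi> e"
    have a: "?a *\<^sub>C e \<in> V" using subspace_scale[OF Vs eV] .
    have ua: "u - ?a *\<^sub>C e \<in> V" using subspace_diff[OF Vs u a] .
    have "u - ?a *\<^sub>C e \<in> ?K"
      using ua clinear_on_diff[OF lin Vs u a] clinear_on_scale[OF lin eV] \<phi>e by simp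
    then have "ip e (u - ?a *\<^sub>C e) = 0" using k(2) e_def by blast
    then have "ip (u - ?a *\<^sub>C e) e = 0" using facts(4)[OF eV ua eV] by simp
    then have "ip u e = ?a * ip e e" using facts(2)[OF u a eV] facts(3)[OF eV eV eV] by simp
    then show ?thesis using \<phi>e by simp
  qed
  then have "cmod (\<phi> u) * cmod (ip e e) = cmod (\<phi> e) * cmod (ip u e)" if "u \<in> V" for u
    using that by (metis norm_mult)
  moreover have "cmod (ip e e) > 0" using ee by auto
  ultimately have eq: "cmod (\<phi> u) = cmod (\<phi> e) * cmod (ip u e) / cmod (ip e e)" if "u \<in> V" for u
    using that by (simp add: field_simps)
  have "cmod (\<phi> u) \<le> (cmod (\<phi> e) * ip_norm ip e / cmod (ip e e)) * ip_norm ip u" if u: "u \<in> V" for u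
  proof -
    have "cmod (\<phi> e) * cmod (ip u e) \<le> cmod (\<phi> e) * (ip_norm ip u * ip_norm ip e)"
      using ip_norm_Cauchy_Schwarz[OF ip Vs u eV] by (intro mult_left_mono) auto
    then show ?thesis unfolding eq[OF u] by (simp add: divide_right_mono algebra_simps)
  qed
  then show ?thesis using that by blast
next
  case False
  then show ?thesis using that[of 0] by simp
qed

section \<open>Definiteness of the dual norm, and consistent least-squares problems\<close>

lemma dual_norm_zero:
  fixes V :: "'a::complex_vector set"
  assumes "inner_product_on V ip" "complex_vector.subspace V"
  shows "dual_norm V (ip_norm ip) 0 = 0"
proof -
  have 0: "0 \<in> V" using subspace_0[OF assms(2)] .
  then have "0 \<in> {u\<in>V. ip_norm ip u \<le> 1}"
    using inner_product_on_facts(11)[OF assms 0 0 0] by (simp add: ip_norm_def)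
  then have "(\<lambda>u. cmod ((0::'a \<Rightarrow> complex) u)) ` {u\<in>V. ip_norm ip u \<le> 1} = {0}"
    unfolding zero_fun_apply norm_zero by blast
  then show ?thesis unfolding dual_norm_def by (simp only: cSup_singleton)
qed

text \<open>As the functional is bounded, the supremum really dominates its values on the unit ball;
  if it is not positive they all vanish, and scaling reaches the rest of \<open>V\<close>.\<close>

lemma dual_norm_le_zero_imp:
  assumes ip: "inner_product_on V ip" and V: "finitely_spanned V" and \<phi>: "\<phi> \<in> cdual V"
    and 0: "dual_norm V (ip_norm ip) \<phi> \<le> 0"
  shows "\<phi> = 0"
proof -
  note Vs = finitely_spanned_subspace[OF V]
  note facts = inner_product_on_facts[OF ip Vs] and lin = cdual_clinear[OF \<phi>]
  obtain C where C: "\<And>u. u \<in> V \<Longrightarrow> cmod (\<phi> u) \<le> C * ip_norm ip u"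
    using cdual_bounded[OF ip V \<phi>] by blast
  have nn: "ip_norm ip u \<ge> 0" if "u \<in> V" for u
    using facts(9)[OF that that that] by (simp add: ip_norm_def)
  have bdd: "bdd_above ((\<lambda>u. cmod (\<phi> u)) ` {u\<in>V. ip_norm ip u \<le> 1})"
  proof (rule bdd_aboveI2)
    fix u assume u: "u \<in> {u\<in>V. ip_norm ip u \<le> 1}"
    then have "C * ip_norm ip u \<le> \<bar>C\<bar> * 1" using nn by (intro mult_mono) auto
    then show "cmod (\<phi> u) \<le> \<bar>C\<bar>" using C u by fastforce
  qed
  have "\<phi> u = 0" if u: "u \<in> V" for u
  proof -
    \<comment> \<open>Dividing by one plus the norm brings \<open>u\<close> into the unit ball and
      covers \<open>u = 0\<close> without a case distinction.\<close>
    define r where "r = 1 / (1 + ip_norm ip u)"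
    have r: "r > 0" "r * ip_norm ip u \<le> 1" using nn[OF u] by (auto simp: r_def field_simps)
    have ru: "of_real r *\<^sub>C u \<in> V" using subspace_scale[OF Vs u] .
    have "ip (of_real r *\<^sub>C u) (of_real r *\<^sub>C u) = of_real (r\<^sup>2) * ip u u"
      using facts(3)[OF u u ru] facts(7)[OF u u u] by (simp add: power2_eq_square)
    then have "ip_norm ip (of_real r *\<^sub>C u) = r * ip_norm ip u"
      using r(1) by (simp add: ip_norm_def real_sqrt_mult)
    then have "cmod (\<phi> (of_real r *\<^sub>C u)) \<le> dual_norm V (ip_norm ip) \<phi>"
      unfolding dual_norm_def using ru r by (intro cSUP_upper[OF _ bdd]) auto
    then have "cmod (of_real r * \<phi> u) \<le> 0"
      using order_trans[OF _ 0] unfolding cdual_scale[OF \<phi> u] by blast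
    then show ?thesis using r(1) by simp
  qed
  then show ?thesis using cdual_off[OF \<phi>] by (auto simp: fun_eq_iff)
qed

text \<open>For \<open>y\<close> in the range the least residual is zero, and definiteness of the
  dual norm makes the least-squares solutions exactly the solutions. They form a translate of the
  kernel, whose unique shortest element \<open>e\<close> is the one orthogonal to the kernel; this
  evaluates the definite description.\<close>

lemma pseudo_inverse_solves:
  assumes ip: "inner_product_on V ip" and V: "finitely_spanned V" and M: "clinear_on V (cdual V) M"
    and y: "y \<in> M ` V"
  shows "pseudo_inverse V ip M y \<in> V" "M (pseudo_inverse V ip M y) = y"
proof -
  note Vs = finitely_spanned_subspace[OF V]
  note facts = inner_product_on_facts[OF ip Vs]
  obtain u0 where u0: "u0 \<in> V" "M u0 = y" using y by blast
  have ls: "least_squares V ip M y = {u\<in>V. M u = y}"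
  proof (intro set_eqI iffI)
    fix u assume u: "u \<in> least_squares V ip M y"
    then have uV: "u \<in> V"
      and "dual_norm V (ip_norm ip) (M u - y) \<le> dual_norm V (ip_norm ip) (M u0 - y)"
      using u0 unfolding least_squares_def by auto
    moreover have "M u0 - y = 0" using u0 by simp
    ultimately have "dual_norm V (ip_norm ip) (M u - y) \<le> 0" using dual_norm_zero[OF ip Vs] by simp
    moreover have "M u - y \<in> cdual V"
      using u0 uV clinear_on_mem[OF M] by (blast intro: subspace_diff[OF subspace_cdual])
    ultimately have "M u - y = 0" using dual_norm_le_zero_imp[OF ip V] by blast
    then show "u \<in> {u\<in>V. M u = y}" using uV by simp
  next
    fix u assume u: "u \<in> {u\<in>V. M u = y}"
    \<comment> \<open>The dual norm is nonnegative: a negative value would force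
      \<open>\<phi> = 0\<close>, whose dual norm is zero.\<close>
    have "dual_norm V (ip_norm ip) 0 \<le> dual_norm V (ip_norm ip) \<phi>" if \<phi>: "\<phi> \<in> cdual V" for \<phi>
      using dual_norm_le_zero_imp[OF ip V \<phi>] dual_norm_zero[OF ip Vs] by fastforce
    moreover have "M w - y \<in> cdual V" if "w \<in> V" for w
      using u0 that clinear_on_mem[OF M] by (blast intro: subspace_diff[OF subspace_cdual])
    moreover have "M u - y = 0" using u by simp
    ultimately show "u \<in> least_squares V ip M y" using u unfolding least_squares_def by simp
  qed
  let ?K = "{v\<in>V. M v = 0}"
  have "finitely_spanned ?K"
    using finitely_spanned_subset[OF V subspace_kernel[OF M Vs]] by auto
  then obtain F where F: "finite F" "?K = complex_vector.span F"
    unfolding finitely_spanned_def by blast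
  then have FV: "F \<subseteq> V" using complex_vector.span_superset[of F] by auto
  obtain k where k: "k \<in> ?K" "\<And>h. h \<in> ?K \<Longrightarrow> ip (u0 - k) h = 0"
    using exists_orthogonal_projection[OF ip Vs F(1) FV u0(1)] F(2) by auto
  define e where "e = u0 - k"
  have eV: "e \<in> V" using subspace_diff[OF Vs u0(1)] k(1) e_def by blast
  have Me: "M e = y" using clinear_on_diff[OF M Vs u0(1), of k] k(1) u0 e_def by simp
  \<comment> \<open>This identity gives both that \<open>e\<close> is shortest and that any other
    shortest solution equals \<open>e\<close>.\<close>
  have split: "(ip_norm ip w)\<^sup>2 = (ip_norm ip e)\<^sup>2 + (ip_norm ip (w - e))\<^sup>2"
    and wV: "w - e \<in> V" if "w \<in> V" "M w = y" for w
  proof -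
    show we: "w - e \<in> V" using subspace_diff[OF Vs that(1) eV] .
    then have "w - e \<in> ?K" using clinear_on_diff[OF M Vs that(1) eV] that Me by simp
    then have "ip e (w - e) = 0" using k(2) e_def by blast
    from ip_norm_pythagoras[OF ip Vs eV we this]
    show "(ip_norm ip w)\<^sup>2 = (ip_norm ip e)\<^sup>2 + (ip_norm ip (w - e))\<^sup>2" by simp
  qed
  have nn: "ip_norm ip w \<ge> 0" if "w \<in> V" for w
    using facts(9)[OF that that that] by (simp add: ip_norm_def)
  have "pseudo_inverse V ip M y = e"
    unfolding pseudo_inverse_def ls
  proof (rule the_equality)
    show "e \<in> {u\<in>V. M u = y} \<and> (\<forall>w\<in>{u\<in>V. M u = y}. ip_norm ip e \<le> ip_norm ip w)"
    proof (intro conjI ballI)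
      fix w assume "w \<in> {u\<in>V. M u = y}"
      then have w: "w \<in> V" "M w = y" by auto
      have "(ip_norm ip e)\<^sup>2 \<le> (ip_norm ip w)\<^sup>2" unfolding split[OF w] by simp
      then show "ip_norm ip e \<le> ip_norm ip w" using nn[OF w(1)] by (rule power2_le_imp_le)
    qed (simp add: eV Me)
  next
    fix w assume w: "w \<in> {u\<in>V. M u = y} \<and> (\<forall>x\<in>{u\<in>V. M u = y}. ip_norm ip w \<le> ip_norm ip x)"
    then have wV': "w \<in> V" "M w = y" and "ip_norm ip w \<le> ip_norm ip e" using eV Me by auto
    then have "(ip_norm ip w)\<^sup>2 \<le> (ip_norm ip e)\<^sup>2"
      using nn by (intro power_mono) auto
    then have "(ip_norm ip (w - e))\<^sup>2 \<le> 0" unfolding split[OF wV'] by simp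
    then have "Re (ip (w - e) (w - e)) = 0" by (simp add: ip_norm_def)
    then have "w - e = 0" using facts(10)[OF wV[OF wV'] eV eV] by blast
    then show "w = e" by simp
  qed
  then show "pseudo_inverse V ip M y \<in> V" "M (pseudo_inverse V ip M y) = y" using eV Me by auto
qed

section \<open>Exchange and scattering operators\<close>

lemma adjoint_apply: "u \<in> V \<Longrightarrow> adjoint_on V L p u = p (L u)"
  by (simp add: adjoint_on_def)

text \<open>With bilinear pairings, \<open>T w (C w)\<close> is the Hermitian energy of
  \<open>w\<close>. Here \<open>C\<close> is just an involution fixing zero; that conjugates stay in
  a given space is supplied separately, by \<open>R_conj\<close> or by a conjugation of the space in
  question.\<close>

locale conjugation_positive =
  fixes W :: "'a::complex_vector set" and C :: "'a \<Rightarrow> 'a" and T :: "'a \<Rightarrow> 'a \<Rightarrow> complex"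
  assumes subspace_W: "complex_vector.subspace W"
    and C_C: "C (C w) = w" and C_0: "C 0 = 0"
    and T: "clinear_on W (cdual W) T"
    and T_pos: "w \<in> W \<Longrightarrow> w \<noteq> 0 \<Longrightarrow> Re (T w (C w)) > 0"

text \<open>\<open>R_conj\<close> makes the range of \<open>R\<close> stable under \<open>C\<close>,
  so that an image can be tested against its own conjugate.\<close>

locale exchange_setting = conjugation_positive W C T
  for W :: "'a::complex_vector set" and C :: "'a \<Rightarrow> 'a" and T :: "'a \<Rightarrow> 'a \<Rightarrow> complex" +
  fixes X :: "'x::complex_vector set" and R :: "'x \<Rightarrow> 'a"
  assumes X: "finitely_spanned X" and R: "clinear_on X W R"
    and R_conj: "x \<in> X \<Longrightarrow> \<exists>x'\<in>X. R x' = C (R x)"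
begin

abbreviation (input) RTR :: "'x \<Rightarrow> 'x \<Rightarrow> complex" where
  "RTR \<equiv> \<lambda>u. adjoint_on X R (T (R u))"

lemma subspace_X: "complex_vector.subspace X"
  using finitely_spanned_subspace[OF X] .

lemma adjoint_R: "clinear_on (cdual W) (cdual X) (adjoint_on X R)"
  using adjoint_clinear[OF R subspace_X] .

lemma TR: "clinear_on X (cdual W) (\<lambda>u. T (R u))"
  using clinear_on_compose[OF R T] .

lemma RTR: "clinear_on X (cdual X) RTR"
  using clinear_on_compose[OF TR adjoint_R] .

text \<open>Testing with an element whose image is the conjugate of \<open>R z\<close> turns the
  assumption into zero energy. Injectivity up to the kernel of \<open>R\<close> is what matters,
  because a preimage enters the exchange operator only through \<open>R\<close>.\<close>

lemma RTR_kernel: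
  assumes z: "z \<in> X" and 0: "RTR z = 0"
  shows "R z = 0"
proof (rule ccontr)
  assume "R z \<noteq> 0"
  then have pos: "Re (T (R z) (C (R z))) > 0" using T_pos clinear_on_mem[OF R z] by blast
  obtain z' where z': "z' \<in> X" "R z' = C (R z)" using R_conj[OF z] by blast
  have "T (R z) (R z') = 0" using fun_cong[OF 0, of z'] z' by (simp add: adjoint_on_def)
  then show False using pos z'(2) by simp
qed

text \<open>Let the range annihilate \<open>v\<close>, and choose \<open>u\<close> with
  \<open>R u = C (R v)\<close>. As \<open>C\<close> is an involution, pairing \<open>u\<close> with
  \<open>v\<close> gives the energy of \<open>R u\<close>; hence \<open>R u\<close> and then
  \<open>R v\<close> vanish, and the adjoint of \<open>R\<close> applied to \<open>p\<close>
  vanishes at \<open>v\<close>.\<close>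

lemma RTR_range:
  assumes p: "p \<in> cdual W"
  shows "adjoint_on X R p \<in> RTR ` X"
proof (rule range_eq_annihilator[OF X subspace_X RTR clinear_on_mem[OF adjoint_R p]])
  fix v assume v: "v \<in> X" "\<And>u. u \<in> X \<Longrightarrow> RTR u v = 0"
  obtain u where u: "u \<in> X" "R u = C (R v)" using R_conj[OF v(1)] by blast
  have "T (R u) (C (R u)) = 0" using v(2)[OF u(1)] v(1) u(2) by (simp add: adjoint_apply C_C)
  then have "R u = 0" using T_pos[OF clinear_on_mem[OF R u(1)]] by force
  then have "R v = 0" using u(2) C_C[of "R v"] C_0 by simp
  then show "adjoint_on X R p v = 0"
    using v(1) clinear_on_zero[OF cdual_clinear[OF p] subspace_W] by (simp add: adjoint_apply)
qed

text \<open>\<open>inv_into\<close> chooses some preimage; two preimages differ by an element of the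
  kernel of \<open>RTR\<close>, which \<open>R\<close> sends to zero. So any preimage
  \<open>x\<close> may be used to evaluate the operator.\<close>

lemma exchange_op_eq:
  assumes p: "p \<in> cdual W" and x: "x \<in> X" "RTR x = adjoint_on X R p"
  shows "exchange_op X R T p = 2 *\<^sub>C T (R x) - p"
proof -
  let ?x = "inv_into X RTR (adjoint_on X R p)"
  have x': "?x \<in> X" "RTR ?x = adjoint_on X R p"
    using inv_into_into[OF RTR_range[OF p]] f_inv_into_f[OF RTR_range[OF p]] by auto
  have "RTR (?x - x) = 0" using clinear_on_diff[OF RTR subspace_X x'(1) x(1)] x(2) x'(2) by simp
  then have "R (?x - x) = 0" using RTR_kernel subspace_diff[OF subspace_X x'(1) x(1)] by blast
  then have "R ?x = R x" using clinear_on_diff[OF R subspace_X x'(1) x(1)] by simp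
  then show ?thesis unfolding exchange_op_def by simp
qed

lemma exchange_op_cases:
  assumes p: "p \<in> cdual W"
  obtains x where "x \<in> X" "RTR x = adjoint_on X R p" "exchange_op X R T p = 2 *\<^sub>C T (R x) - p"
  using RTR_range[OF p] exchange_op_eq[OF p] by (metis (no_types, lifting) image_iff)

text \<open>The chosen preimage need not depend linearly on \<open>p\<close>, but sums and multiples
  of preimages are preimages of sums and multiples, and any preimage will do.\<close>

lemma exchange_op_linear: "clinear_on (cdual W) (cdual W) (exchange_op X R T)"
proof (rule clinear_onI)
  fix p assume p: "p \<in> cdual W"
  obtain x where x: "x \<in> X" "RTR x = adjoint_on X R p" "exchange_op X R T p = 2 *\<^sub>C T (R x) - p"
    using exchange_op_cases[OF p] .
  show "exchange_op X R T p \<in> cdual W"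
    unfolding x(3)
    by (intro subspace_diff[OF subspace_cdual] subspace_scale[OF subspace_cdual]
        clinear_on_mem[OF TR x(1)] p)
  show "exchange_op X R T (a *\<^sub>C p) = a *\<^sub>C exchange_op X R T p" for a
  proof -
    have ax: "a *\<^sub>C x \<in> X" using subspace_scale[OF subspace_X x(1)] .
    have "RTR (a *\<^sub>C x) = adjoint_on X R (a *\<^sub>C p)"
      using clinear_on_scale[OF RTR x(1)] clinear_on_scale[OF adjoint_R p] x(2) by simp
    from exchange_op_eq[OF subspace_scale[OF subspace_cdual p] ax this]
    show ?thesis unfolding x(3) clinear_on_scale[OF TR x(1)]
      by (simp add: complex_vector.scale_right_diff_distrib scaleC_scaleC mult.commute)
  qed
  fix q assume q: "q \<in> cdual W"
  obtain y where y: "y \<in> X" "RTR y = adjoint_on X R q" "exchange_op X R T q = 2 *\<^sub>C T (R y) - q"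
    using exchange_op_cases[OF q] .
  have "RTR (x + y) = adjoint_on X R (p + q)"
    using clinear_on_add[OF RTR x(1) y(1)] clinear_on_add[OF adjoint_R p q] x(2) y(2) by simp
  from exchange_op_eq[OF subspace_add[OF subspace_cdual p q] subspace_add[OF subspace_X x(1) y(1)] this]
  show "exchange_op X R T (p + q) = exchange_op X R T p + exchange_op X R T q"
    unfolding x(3) y(3) clinear_on_add[OF TR x(1) y(1)] by (simp add: scaleC_add_right)
qed

text \<open>The adjoint of \<open>R\<close> takes the same value at \<open>p\<close> and at its
  image, since twice that value minus itself remains. So the same \<open>x\<close> serves for the
  second application, and the two terms with \<open>T (R x)\<close> cancel.\<close>

lemma exchange_op_involutive:
  assumes p: "p \<in> cdual W"
  shows "exchange_op X R T (exchange_op X R T p) = p"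
proof -
  obtain x where x: "x \<in> X" "RTR x = adjoint_on X R p" "exchange_op X R T p = 2 *\<^sub>C T (R x) - p"
    using exchange_op_cases[OF p] .
  have Tx: "T (R x) \<in> cdual W" using clinear_on_mem[OF TR x(1)] .
  have 2: "2 *\<^sub>C T (R x) \<in> cdual W" using subspace_scale[OF subspace_cdual Tx] .
  have Pp: "2 *\<^sub>C T (R x) - p \<in> cdual W" using subspace_diff[OF subspace_cdual 2 p] .
  have "adjoint_on X R (2 *\<^sub>C T (R x) - p) = 2 *\<^sub>C adjoint_on X R p - adjoint_on X R p"
    unfolding clinear_on_diff[OF adjoint_R subspace_cdual 2 p] clinear_on_scale[OF adjoint_R Tx] x(2) ..
  then have "RTR x = adjoint_on X R (2 *\<^sub>C T (R x) - p)" by (simp add: x(2) scaleC_two)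
  from exchange_op_eq[OF Pp x(1) this] show ?thesis unfolding x(3) by simp
qed

end

section \<open>The operator \<open>M\<close>, and the passage between the two formulations\<close>

lemma impedance_problem_op_linear:
  assumes V: "complex_vector.subspace V" and A: "clinear_on V (cdual V) A"
    and B: "clinear_on V W B" and T: "clinear_on W (cdual W) T"
  shows "clinear_on V (cdual V) (impedance_problem_op V A B T)"
proof -
  have L: "clinear_on V (cdual V) (\<lambda>u. adjoint_on V B (T (B u)))"
    using clinear_on_compose[OF clinear_on_compose[OF B T] adjoint_clinear[OF B V]] .
  show ?thesis
  proof (rule clinear_onI)
    fix x assume x: "x \<in> V"
    show "impedance_problem_op V A B T x \<in> cdual V" unfolding impedance_problem_op_def
      by (intro subspace_diff[OF subspace_cdual] subspace_scale[OF subspace_cdual]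
          clinear_on_mem[OF A x] clinear_on_mem[OF L x])
    show "impedance_problem_op V A B T (a *\<^sub>C x) = a *\<^sub>C impedance_problem_op V A B T x" for a
      unfolding impedance_problem_op_def clinear_on_scale[OF A x] clinear_on_scale[OF L x]
      by (simp add: complex_vector.scale_right_diff_distrib scaleC_scaleC mult.commute)
    fix y assume y: "y \<in> V"
    show "impedance_problem_op V A B T (x + y)
        = impedance_problem_op V A B T x + impedance_problem_op V A B T y"
      unfolding impedance_problem_op_def clinear_on_add[OF A x y] clinear_on_add[OF L x y]
      by (simp add: scaleC_add_right)
  qed
qed

text \<open>\<open>D\<close> is the conjugation of \<open>V\<close>, compatible with the trace. The
  energy estimate uses only that the number \<open>M u (D u)\<close> vanishes. For \<open>v\<close>
  annihilated by the range this holds with \<open>D v\<close> in place of \<open>u\<close>, because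
  \<open>D (D v) = v\<close>. Once \<open>B v = 0\<close>, the value \<open>M u v\<close> reduces to
  \<open>A u v\<close>.\<close>

lemma (in conjugation_positive) dissipative_kernel_and_range:
  assumes V: "finitely_spanned V" and A: "clinear_on V (cdual V) A" and B: "clinear_on V W B"
    and D: "\<And>v. v \<in> V \<Longrightarrow> D v \<in> V" "\<And>v. v \<in> V \<Longrightarrow> D (D v) = v" "\<And>v. v \<in> V \<Longrightarrow> B (D v) = C (B v)"
    and dissipative: "\<And>v. v \<in> V \<Longrightarrow> Im (A v (D v)) \<le> 0"
    and M: "M = impedance_problem_op V A B T"
  shows "\<And>u. u \<in> V \<Longrightarrow> M u = 0 \<Longrightarrow> B u = 0"
    and "\<And>u p. u \<in> V \<Longrightarrow> p \<in> cdual W \<Longrightarrow> A u + adjoint_on V B p \<in> M ` V"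
proof -
  note Vs = finitely_spanned_subspace[OF V]
  have Mlin: "clinear_on V (cdual V) M"
    unfolding M using impedance_problem_op_linear[OF Vs A B T] .
  have M_apply: "M u v = A u v - \<i> * T (B u) (B v)" if "v \<in> V" for u v
    using that by (simp add: M impedance_problem_op_def adjoint_apply)
  have Bz: "B u = 0" if u: "u \<in> V" and 0: "M u (D u) = 0" for u
  proof (rule ccontr)
    assume "B u \<noteq> 0"
    then have "Re (T (B u) (C (B u))) > 0" using T_pos clinear_on_mem[OF B u] by blast
    moreover have "Im (A u (D u) - \<i> * T (B u) (C (B u))) = 0"
      using 0 M_apply[OF D(1)[OF u]] D(3)[OF u] by simp
    ultimately show False using dissipative[OF u] by simp
  qed
  then show "\<And>u. u \<in> V \<Longrightarrow> M u = 0 \<Longrightarrow> B u = 0" by simp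
  fix u p assume u: "u \<in> V" and p: "p \<in> cdual W"
  have adj: "adjoint_on V B p \<in> cdual V" using clinear_on_mem[OF adjoint_clinear[OF B Vs] p] .
  show "A u + adjoint_on V B p \<in> M ` V"
  proof (rule range_eq_annihilator[OF V Vs Mlin subspace_add[OF subspace_cdual clinear_on_mem[OF A u] adj]])
    fix v assume v: "v \<in> V" "\<And>u. u \<in> V \<Longrightarrow> M u v = 0"
    have "M (D v) (D (D v)) = 0" using v D(1,2) by simp
    then have "B (D v) = 0" using Bz D(1) v(1) by blast
    then have Bv: "B v = 0" using D(3)[OF v(1)] C_C[of "B v"] C_0 by simp
    have "T (B u) 0 = 0"
      using clinear_on_zero[OF cdual_clinear subspace_W] clinear_on_mem[OF T clinear_on_mem[OF B u]] by blast
    then have "A u v = 0" using v(2)[OF u] M_apply[OF v(1)] Bv by simp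
    moreover have "adjoint_on V B p v = 0"
      using Bv v(1) clinear_on_zero[OF cdual_clinear[OF p] subspace_W] by (simp add: adjoint_apply)
    ultimately show "(A u + adjoint_on V B p) v = 0" by simp
  qed
qed

text \<open>All analysis is concentrated in \<open>ker\<close> and \<open>ran\<close>, and
  \<open>P\<close> is an arbitrary linear involution. The range condition on \<open>l\<close> puts
  \<open>l\<close> and \<open>Bs q + l\<close> into the range of \<open>M\<close>, so the
  pseudo-inverse acts there as a right inverse.\<close>

lemma scattering_equivalence:
  assumes ip: "inner_product_on V ip" and V: "finitely_spanned V" and W: "complex_vector.subspace W"
    and A: "clinear_on V (cdual V) A" and B: "clinear_on V W B" and T: "clinear_on W (cdual W) T"
    and P: "clinear_on (cdual W) (cdual W) P" "\<forall>p\<in>cdual W. P (P p) = p"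
    and M: "M = impedance_problem_op V A B T" and Mp: "Mp = pseudo_inverse V ip M"
    and S: "S = scattering_op V ip A B T" and Bs: "Bs = adjoint_on V B"
    and ker: "\<forall>u\<in>V. M u = 0 \<longrightarrow> B u = 0"
    and ran: "\<forall>u\<in>V. \<forall>p\<in>cdual W. A u + Bs p \<in> M ` V"
    and l: "l \<in> {A u + Bs p | u p. u \<in> V \<and> p \<in> cdual W}"
  shows "\<And>u p. u \<in> V \<Longrightarrow> p \<in> cdual W \<Longrightarrow> A u - Bs p = l \<Longrightarrow>
      - p + \<i> *\<^sub>C T (B u) = P (p + \<i> *\<^sub>C T (B u)) \<Longrightarrow>
      (p - \<i> *\<^sub>C T (B u)) + P (S (p - \<i> *\<^sub>C T (B u))) = - ((2 * \<i>) *\<^sub>C P (T (B (Mp l))))"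
    and "\<And>q. q \<in> cdual W \<Longrightarrow> q + P (S q) = - ((2 * \<i>) *\<^sub>C P (T (B (Mp l)))) \<Longrightarrow>
      Mp (Bs q + l) \<in> V \<and>
      A (Mp (Bs q + l)) - Bs ((1 / 2) *\<^sub>C (q - P q)) = l \<and>
      - ((1 / 2) *\<^sub>C (q - P q)) + \<i> *\<^sub>C T (B (Mp (Bs q + l)))
        = P ((1 / 2) *\<^sub>C (q - P q) + \<i> *\<^sub>C T (B (Mp (Bs q + l))))"
proof -
  note Vs = finitely_spanned_subspace[OF V] and cd = subspace_cdual
  have Mlin: "clinear_on V (cdual V) M"
    unfolding M using impedance_problem_op_linear[OF Vs A B T] .
  have Bsl: "clinear_on (cdual W) (cdual V) Bs" unfolding Bs using adjoint_clinear[OF B Vs] .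
  have TB: "clinear_on V (cdual W) (\<lambda>u. T (B u))" using clinear_on_compose[OF B T] .
  have M_eq: "M u = A u - \<i> *\<^sub>C Bs (T (B u))" for u by (simp add: M Bs impedance_problem_op_def)
  have Mp_V: "Mp y \<in> V" and M_Mp: "M (Mp y) = y" if "y \<in> M ` V" for y
    unfolding Mp using pseudo_inverse_solves[OF ip V Mlin that] by auto
  \<comment> \<open>The trace of a preimage under \<open>M\<close> depends only on its image, so the
    choice made by the pseudo-inverse is invisible after \<open>B\<close>.\<close>
  have TB_eq: "T (B u) = T (B v)" if "u \<in> V" "v \<in> V" "M u = M v" for u v
  proof -
    have "M (u - v) = 0" using clinear_on_diff[OF Mlin Vs that(1,2)] that(3) by simp
    then have "B (u - v) = 0" using ker subspace_diff[OF Vs that(1,2)] by blast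
    then show ?thesis using clinear_on_diff[OF B Vs that(1,2)] by simp
  qed
  obtain u0 p0 where l0: "l = A u0 + Bs p0" "u0 \<in> V" "p0 \<in> cdual W" using l by blast
  have lM: "l \<in> M ` V" using ran l0 by blast
  have qM: "Bs q \<in> M ` V" if "q \<in> cdual W" for q
    using ran[rule_format, OF subspace_0[OF Vs] that] clinear_on_zero[OF A Vs] by simp
  have qlM: "Bs q + l \<in> M ` V" if "q \<in> cdual W" for q
    using ran[rule_format, OF l0(2) subspace_add[OF cd l0(3) that]] clinear_on_add[OF Bsl l0(3) that] l0(1)
    by (simp add: algebra_simps)
  \<comment> \<open>\<open>u\<close> is compared with \<open>Mp (Bs q) + Mp l\<close>, which has the
    same image under \<open>M\<close>; the contribution of \<open>l\<close> is then split
    off.\<close>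
  have S_eq: "S q = q + (2 * \<i>) *\<^sub>C T (B u) - (2 * \<i>) *\<^sub>C T (B (Mp l))"
    if q: "q \<in> cdual W" and u: "u \<in> V" "M u = Bs q + l" for q u
  proof -
    note mem = Mp_V[OF qM[OF q]] Mp_V[OF lM]
    have "M u = M (Mp (Bs q) + Mp l)"
      unfolding clinear_on_add[OF Mlin mem] M_Mp[OF lM] M_Mp[OF qM[OF q]] u(2) ..
    then have "T (B u) = T (B (Mp (Bs q) + Mp l))" using TB_eq u(1) subspace_add[OF Vs mem] by blast
    then have "T (B (Mp (Bs q))) = T (B u) - T (B (Mp l))" using clinear_on_add[OF TB mem] by simp
    moreover have "S q = q + (2 * \<i>) *\<^sub>C T (B (Mp (Bs q)))"
      by (simp add: S scattering_op_def Mp M Bs)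
    ultimately show ?thesis by (simp add: complex_vector.scale_right_diff_distrib)
  qed
  note Pd = clinear_on_diff[OF P(1) cd] and Pa = clinear_on_add[OF P(1)] and Ps = clinear_on_scale[OF P(1)]
  {
    fix u p assume u: "u \<in> V" and p: "p \<in> cdual W" and eq: "A u - Bs p = l"
      and ex: "- p + \<i> *\<^sub>C T (B u) = P (p + \<i> *\<^sub>C T (B u))"
    define t where "t = T (B u)"
    define s where "s = T (B (Mp l))"
    have t: "t \<in> cdual W" and s: "s \<in> cdual W"
      using clinear_on_mem[OF TB u] clinear_on_mem[OF TB Mp_V[OF lM]] by (auto simp: t_def s_def)
    have it: "\<i> *\<^sub>C t \<in> cdual W" and s2: "(2 * \<i>) *\<^sub>C s \<in> cdual W"
      using subspace_scale[OF cd] t s by auto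
    have q: "p - \<i> *\<^sub>C t \<in> cdual W" using subspace_diff[OF cd p it] .
    \<comment> \<open>Subtracting \<open>\<i> *\<^sub>C Bs t\<close> on both sides of the first
      equation of (1) explains the choice of \<open>q\<close>: it is the incoming datum of the
      impedance problem solved by \<open>u\<close>, and \<open>S_eq\<close> turns it into
      \<open>p + \<i> *\<^sub>C t\<close> up to the source term.\<close>
    have "M u = Bs (p - \<i> *\<^sub>C t) + l"
      unfolding clinear_on_diff[OF Bsl cd p it] clinear_on_scale[OF Bsl t] M_eq
      by (simp add: eq[symmetric] t_def)
    from S_eq[OF q u this] have "S (p - \<i> *\<^sub>C t) = (p + \<i> *\<^sub>C t) - (2 * \<i>) *\<^sub>C s"
      unfolding t_def[symmetric] s_def[symmetric]
      by (simp add: fun_eq_iff algebra_simps)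
    then have "P (S (p - \<i> *\<^sub>C t)) = P (p + \<i> *\<^sub>C t) - (2 * \<i>) *\<^sub>C P s"
      using Pd[OF subspace_add[OF cd p it] s2] Ps[OF s] by simp
    also have "\<dots> = - p + \<i> *\<^sub>C t - (2 * \<i>) *\<^sub>C P s" using ex by (simp add: t_def)
    finally show "(p - \<i> *\<^sub>C T (B u)) + P (S (p - \<i> *\<^sub>C T (B u))) = - ((2 * \<i>) *\<^sub>C P (T (B (Mp l))))"
      by (simp add: t_def s_def)
  next
    fix q assume q: "q \<in> cdual W" and eq: "q + P (S q) = - ((2 * \<i>) *\<^sub>C P (T (B (Mp l))))"
    define u where "u = Mp (Bs q + l)"
    define t where "t = T (B u)"
    define s where "s = T (B (Mp l))"
    have u: "u \<in> V" and Mu: "M u = Bs q + l"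
      using Mp_V M_Mp qlM[OF q] by (auto simp: u_def)
    have t: "t \<in> cdual W" and s: "s \<in> cdual W"
      using clinear_on_mem[OF TB u] clinear_on_mem[OF TB Mp_V[OF lM]] by (auto simp: t_def s_def)
    have it: "\<i> *\<^sub>C t \<in> cdual W" and s2: "(2 * \<i>) *\<^sub>C s \<in> cdual W" and t2: "(2 * \<i>) *\<^sub>C t \<in> cdual W"
      using subspace_scale[OF cd] t s by auto
    have Pq: "P q \<in> cdual W" and Pt: "P t \<in> cdual W" using clinear_on_mem[OF P(1)] q t by auto
    have "S q = q + (2 * \<i>) *\<^sub>C t - (2 * \<i>) *\<^sub>C s" using S_eq[OF q u Mu] by (simp add: t_def s_def)
    then have "P (S q) = P q + (2 * \<i>) *\<^sub>C P t - (2 * \<i>) *\<^sub>C P s"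
      using Pd[OF subspace_add[OF cd q t2] s2] Pa[OF q t2] Ps[OF t] Ps[OF s] by simp
    moreover have "(2 * \<i>) *\<^sub>C P s = - (q + P (S q))" using eq by (simp add: s_def)
    ultimately have "q + P q + (2 * \<i>) *\<^sub>C P t = 0" by (simp add: add_ac)
    then have 1: "q + P q = (2 * \<i>) *\<^sub>C (- P t)" by (simp add: eq_neg_iff_add_eq_0)
    \<comment> \<open>The left side of \<open>1\<close> is invariant under \<open>P\<close>, while
      on the right \<open>P t\<close> becomes \<open>t\<close>. Comparison yields
      \<open>P t = t\<close>, the trace half of the exchange relation.\<close>
    have "P (q + P q) = P q + q" using Pa[OF q Pq] bspec[OF P(2) q] by simp
    moreover have "P ((2 * \<i>) *\<^sub>C (- P t)) = (2 * \<i>) *\<^sub>C (- t)"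
      using Ps[OF complex_vector.subspace_neg[OF cd Pt]] clinear_on_minus[OF P(1) Pt] bspec[OF P(2) t] by simp
    ultimately have 2: "q + P q = (2 * \<i>) *\<^sub>C (- t)" using 1 by (simp add: add.commute)
    then have "(2 * \<i>) *\<^sub>C P t = (2 * \<i>) *\<^sub>C t" using 1 by simp
    then have Pt_t: "P t = t"
      using complex_vector.scale_left_imp_eq[of "2 * \<i>" "P t" t] by simp
    define p where "p = (1 / 2) *\<^sub>C (q - P q)"
    have qPq: "q - P q \<in> cdual W" using subspace_diff[OF cd q Pq] .
    have p: "p \<in> cdual W" unfolding p_def using subspace_scale[OF cd qPq] .
    have "P p = (1 / 2) *\<^sub>C (P q - q)"
      unfolding p_def Ps[OF qPq] Pd[OF q Pq] bspec[OF P(2) q] ..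
    then have Pp: "P p = - p" by (simp add: p_def fun_eq_iff algebra_simps)
    have ex: "- p + \<i> *\<^sub>C t = P (p + \<i> *\<^sub>C t)"
      unfolding Pa[OF p it] Ps[OF t] Pp Pt_t ..
    \<comment> \<open>Removing half of \<open>q + P q\<close> from \<open>q\<close> leaves
      \<open>p\<close>, and by \<open>2\<close> that half is \<open>- (\<i> *\<^sub>C t)\<close>.
      Adding the impedance term to \<open>q\<close> in the equation for \<open>u\<close> thus
      restores \<open>p\<close>.\<close>
    have qp: "q + \<i> *\<^sub>C t = p"
    proof -
      have "q x + P q x = - (2 * \<i> * t x)" for x using fun_cong[OF 2, of x] by simp
      then have "P q x = - q x - 2 * \<i> * t x" for x
        unfolding eq_diff_eq by (simp add: eq_neg_iff_add_eq_0 algebra_simps)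
      then show ?thesis by (simp add: p_def fun_eq_iff field_simps)
    qed
    have "A u - Bs p = l"
    proof -
      have "A u = Bs q + \<i> *\<^sub>C Bs t + l" using Mu M_eq[of u] by (simp add: t_def algebra_simps)
      also have "\<dots> = Bs p + l"
        unfolding qp[symmetric] clinear_on_add[OF Bsl q it] clinear_on_scale[OF Bsl t] ..
      finally show ?thesis by simp
    qed
    with ex u show "Mp (Bs q + l) \<in> V \<and>
      A (Mp (Bs q + l)) - Bs ((1 / 2) *\<^sub>C (q - P q)) = l \<and>
      - ((1 / 2) *\<^sub>C (q - P q)) + \<i> *\<^sub>C T (B (Mp (Bs q + l)))
        = P ((1 / 2) *\<^sub>C (q - P q) + \<i> *\<^sub>C T (B (Mp (Bs q + l))))"
      by (simp add: u_def t_def p_def)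
  }
qed

section \<open>Sobolev and finite element spaces\<close>

lemma polyhedral_open_imp:
  assumes "polyhedral_open \<Omega>"
  shows "open \<Omega>" "bounded \<Omega>"
proof -
  obtain F where F: "finite F" "\<forall>P\<in>F. polytope P" "\<Omega> = interior (\<Union>F)"
    using assms unfolding polyhedral_open_def by blast
  have "bounded (\<Union>F)" using F polytope_imp_bounded by (intro bounded_Union) auto
  then show "open \<Omega>" "bounded \<Omega>" using F by (auto simp: bounded_interior)
qed

section \<open>Square-integrable functions and weak gradients\<close>

lemma set_borel_measurable_norm_squared:
  fixes f :: "'a \<Rightarrow> 'b::{real_normed_vector,second_countable_topology}"
  assumes "set_borel_measurable M A f"
  shows "set_borel_measurable M A (\<lambda>x. (norm (f x))\<^sup>2)"
proof -
  have eq: "(\<lambda>x. indicator A x *\<^sub>R (norm (f x))\<^sup>2) = (\<lambda>x. (norm (indicator A x *\<^sub>R f x))\<^sup>2)"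
    by (auto simp: indicator_def)
  show ?thesis
    unfolding set_borel_measurable_def eq
    using assms[unfolded set_borel_measurable_def] by measurable
qed

text \<open>Real linearity is the right generality: it covers complex scalars, conjugation and the
  components of a gradient at once.\<close>

lemma square_integrable_bounded_linear:
  fixes h :: "'b::{real_normed_vector,second_countable_topology} \<Rightarrow> 'c::{real_normed_vector,second_countable_topology}"
  assumes h: "bounded_linear h" and f: "f square_integrable_on \<Omega>"
  shows "(\<lambda>x. h (f x)) square_integrable_on \<Omega>"
proof -
  obtain K where K: "\<And>z. norm (h z) \<le> norm z * K" using bounded_linear.bounded[OF h] by blast
  have fm: "(\<lambda>x. indicator \<Omega> x *\<^sub>R f x) \<in> borel_measurable lebesgue"
    and fi: "set_integrable lebesgue \<Omega> (\<lambda>x. (norm (f x))\<^sup>2)"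
    using f unfolding square_integrable_on_def set_borel_measurable_def by auto
  have hm: "h \<in> borel_measurable borel"
    by (intro borel_measurable_continuous_onI linear_continuous_on h)
  have "(\<lambda>x. indicator \<Omega> x *\<^sub>R h (f x)) = (\<lambda>x. h (indicator \<Omega> x *\<^sub>R f x))"
    by (simp add: linear_cmul[OF bounded_linear.linear[OF h]])
  then have m: "(\<lambda>x. indicator \<Omega> x *\<^sub>R h (f x)) \<in> borel_measurable lebesgue"
    using measurable_compose[OF fm hm] by simp
  have "set_integrable lebesgue \<Omega> (\<lambda>x. (norm (h (f x)))\<^sup>2)"
  proof (rule set_integrable_bound)
    show "set_integrable lebesgue \<Omega> (\<lambda>x. K\<^sup>2 * (norm (f x))\<^sup>2)" using fi by simp
    show "set_borel_measurable lebesgue \<Omega> (\<lambda>x. (norm (h (f x)))\<^sup>2)"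
      using m by (intro set_borel_measurable_norm_squared) (simp add: set_borel_measurable_def)
    have "(norm (h z))\<^sup>2 \<le> K\<^sup>2 * (norm z)\<^sup>2" for z
      using power_mono[OF K[of z], of 2] by (simp add: power_mult_distrib mult.commute)
    then show "AE x in lebesgue. x \<in> \<Omega> \<longrightarrow> norm ((norm (h (f x)))\<^sup>2) \<le> norm (K\<^sup>2 * (norm (f x))\<^sup>2)"
      by simp
  qed
  then show ?thesis unfolding square_integrable_on_def set_borel_measurable_def using m by blast
qed

lemma square_integrable_add:
  fixes f g :: "_ \<Rightarrow> 'b::{real_normed_vector,second_countable_topology}"
  assumes f: "f square_integrable_on \<Omega>" and g: "g square_integrable_on \<Omega>"
  shows "(\<lambda>x. f x + g x) square_integrable_on \<Omega>"
proof -
  have fm: "(\<lambda>x. indicator \<Omega> x *\<^sub>R f x) \<in> borel_measurable lebesgue"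
    and fi: "set_integrable lebesgue \<Omega> (\<lambda>x. (norm (f x))\<^sup>2)"
    and gm: "(\<lambda>x. indicator \<Omega> x *\<^sub>R g x) \<in> borel_measurable lebesgue"
    and gi: "set_integrable lebesgue \<Omega> (\<lambda>x. (norm (g x))\<^sup>2)"
    using f g unfolding square_integrable_on_def set_borel_measurable_def by auto
  have m: "(\<lambda>x. indicator \<Omega> x *\<^sub>R (f x + g x)) \<in> borel_measurable lebesgue"
    using borel_measurable_add[OF fm gm] by (simp add: scaleR_add_right)
  have "set_integrable lebesgue \<Omega> (\<lambda>x. (norm (f x + g x))\<^sup>2)"
  proof (rule set_integrable_bound)
    show "set_integrable lebesgue \<Omega> (\<lambda>x. 2 * (norm (f x))\<^sup>2 + 2 * (norm (g x))\<^sup>2)"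
      using fi gi by simp
    show "set_borel_measurable lebesgue \<Omega> (\<lambda>x. (norm (f x + g x))\<^sup>2)"
      using m by (intro set_borel_measurable_norm_squared) (simp add: set_borel_measurable_def)
    have "(norm (a + b))\<^sup>2 \<le> 2 * (norm a)\<^sup>2 + 2 * (norm b)\<^sup>2" for a b :: 'b
    proof -
      have "(norm (a + b))\<^sup>2 \<le> (norm a + norm b)\<^sup>2" by (intro power_mono norm_triangle_ineq) simp
      also have "\<dots> \<le> 2 * (norm a)\<^sup>2 + 2 * (norm b)\<^sup>2"
        using sum_squares_bound[of "norm a" "norm b"] by (simp add: power2_sum)
      finally show ?thesis .
    qed
    then show "AE x in lebesgue. x \<in> \<Omega> \<longrightarrow>
        norm ((norm (f x + g x))\<^sup>2) \<le> norm (2 * (norm (f x))\<^sup>2 + 2 * (norm (g x))\<^sup>2)"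
      by simp
  qed
  then show ?thesis unfolding square_integrable_on_def set_borel_measurable_def using m by blast
qed

text \<open>On a bounded set constants are integrable, so \<open>u\<close> is dominated by one plus
  its squared modulus, while \<open>\<phi>\<close> is bounded on the compact closure. This makes the
  integrals that define weak gradients additive.\<close>

lemma square_integrable_times_continuous:
  fixes u :: "real ^ 'n \<Rightarrow> complex" and \<phi> :: "real ^ 'n \<Rightarrow> real"
  assumes \<Omega>: "open \<Omega>" "bounded \<Omega>" and u: "u square_integrable_on \<Omega>" and \<phi>: "continuous_on UNIV \<phi>"
  shows "set_integrable lebesgue \<Omega> (\<lambda>x. u x * of_real (\<phi> x))"
proof -
  have um: "(\<lambda>x. indicator \<Omega> x *\<^sub>R u x) \<in> borel_measurable lebesgue"
    and ui: "set_integrable lebesgue \<Omega> (\<lambda>x. (norm (u x))\<^sup>2)"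
    using u unfolding square_integrable_on_def set_borel_measurable_def by auto
  have "compact (\<phi> ` closure \<Omega>)"
    using \<Omega> \<phi> by (intro compact_continuous_image) (auto intro: continuous_on_subset)
  from compact_imp_bounded[OF this] obtain C where C: "\<And>x. x \<in> closure \<Omega> \<Longrightarrow> \<bar>\<phi> x\<bar> \<le> C"
    unfolding bounded_iff by auto
  have \<phi>m: "(\<lambda>x. complex_of_real (\<phi> x)) \<in> borel_measurable lebesgue"
    by (intro measurable_completion) (use borel_measurable_continuous_onI[OF continuous_on_of_real[OF \<phi>]] in simp)
  have 1: "set_integrable lebesgue \<Omega> (\<lambda>x. 1::real)"
    using lmeasurable_open[OF \<Omega>(2,1)] unfolding set_integrable_def fmeasurable_def by auto
  show ?thesis
  proof (rule set_integrable_bound)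
    show "set_integrable lebesgue \<Omega> (\<lambda>x. \<bar>C\<bar> * (1 + (norm (u x))\<^sup>2))" using ui 1 by simp
    have "(\<lambda>x. indicator \<Omega> x *\<^sub>R (u x * of_real (\<phi> x))) = (\<lambda>x. (indicator \<Omega> x *\<^sub>R u x) * of_real (\<phi> x))"
      by auto
    then show "set_borel_measurable lebesgue \<Omega> (\<lambda>x. u x * of_real (\<phi> x))"
      unfolding set_borel_measurable_def using borel_measurable_times[OF um \<phi>m] by simp
    have "norm (u x * of_real (\<phi> x)) \<le> norm (\<bar>C\<bar> * (1 + (norm (u x))\<^sup>2))" if x: "x \<in> \<Omega>" for x
    proof -
      have "norm (u x) \<le> 1 + (norm (u x))\<^sup>2"
        using sum_squares_bound[of 1 "norm (u x)"] norm_ge_zero[of "u x"]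
        unfolding mult_1_right one_power2 by linarith
      moreover have "\<bar>\<phi> x\<bar> \<le> \<bar>C\<bar>" using C[of x] x closure_subset by force
      ultimately have "norm (u x) * \<bar>\<phi> x\<bar> \<le> (1 + (norm (u x))\<^sup>2) * \<bar>C\<bar>"
        by (intro mult_mono) auto
      then show ?thesis by (simp add: norm_mult abs_mult mult.commute)
    qed
    then show "AE x in lebesgue. x \<in> \<Omega> \<longrightarrow> norm (u x * of_real (\<phi> x)) \<le> norm (\<bar>C\<bar> * (1 + (norm (u x))\<^sup>2))"
      by simp
  qed
qed

lemma test_function_continuous:
  assumes "test_function \<Omega> \<phi>"
  shows "continuous_on UNIV \<phi>" "continuous_on UNIV (partial i \<phi>)"
proof -
  have *: "continuous_on UNIV (foldr partial is \<phi>)" for "is"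
    using assms unfolding test_function_def smooth_def by blast
  show "continuous_on UNIV \<phi>" "continuous_on UNIV (partial i \<phi>)"
    using *[of "[]"] *[of "[i]"] by auto
qed

lemma square_integrable_component:
  "g square_integrable_on \<Omega> \<Longrightarrow> (\<lambda>x. g x $ i) square_integrable_on \<Omega>"
  by (rule square_integrable_bounded_linear[OF bounded_linear_vec_nth])

lemma weak_gradient_add:
  assumes \<Omega>: "open \<Omega>" "bounded \<Omega>" and u: "u square_integrable_on \<Omega>" "weak_gradient \<Omega> u g"
    and v: "v square_integrable_on \<Omega>" "weak_gradient \<Omega> v h"
  shows "weak_gradient \<Omega> (\<lambda>x. u x + v x) (\<lambda>x. g x + h x)"
proof -
  have g: "g square_integrable_on \<Omega>" and h: "h square_integrable_on \<Omega>"
    using u v unfolding weak_gradient_def by auto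
  note int = square_integrable_times_continuous[OF \<Omega>]
  show ?thesis unfolding weak_gradient_def
  proof (intro conjI allI impI square_integrable_add g h)
    fix \<phi> i assume \<phi>: "test_function \<Omega> \<phi>"
    note c = test_function_continuous[OF \<phi>]
    show "set_lebesgue_integral lebesgue \<Omega> (\<lambda>x. (u x + v x) * of_real (partial i \<phi> x)) =
        - set_lebesgue_integral lebesgue \<Omega> (\<lambda>x. (g x + h x) $ i * of_real (\<phi> x))"
      using u(2) v(2) \<phi> unfolding weak_gradient_def
      by (simp add: distrib_right set_integral_add(2)[OF int[OF u(1) c(2)] int[OF v(1) c(2)]]
          set_integral_add(2)[OF int[OF square_integrable_component[OF g] c(1)]
            int[OF square_integrable_component[OF h] c(1)]])
  qed
qed

text \<open>Test functions are real valued, so a real-linear \<open>k\<close> passes through the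
  product and through the integral; it acts on the gradient componentwise. With \<open>k\<close> the
  conjugation this makes the Sobolev space stable under conjugation.\<close>

lemma weak_gradient_bounded_linear:
  fixes k :: "complex \<Rightarrow> complex"
  assumes \<Omega>: "open \<Omega>" "bounded \<Omega>" and k: "bounded_linear k"
    and u: "u square_integrable_on \<Omega>" "weak_gradient \<Omega> u g"
  shows "weak_gradient \<Omega> (\<lambda>x. k (u x)) (\<lambda>x. \<chi> i. k (g x $ i))"
proof -
  have g: "g square_integrable_on \<Omega>" using u unfolding weak_gradient_def by auto
  have "linear (\<lambda>z::complex^'n. \<chi> i. k (z $ i))"
    using bounded_linear.linear[OF k] by (auto intro!: linearI simp: vec_eq_iff linear_add linear_cmul)
  then have K: "bounded_linear (\<lambda>z::complex^'n. \<chi> i. k (z $ i))"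
    by (simp add: linear_conv_bounded_linear)
  note int = square_integrable_times_continuous[OF \<Omega>]
  have k_int: "set_lebesgue_integral lebesgue \<Omega> (\<lambda>x. k (f x) * of_real (\<phi> x))
      = k (set_lebesgue_integral lebesgue \<Omega> (\<lambda>x. f x * of_real (\<phi> x)))"
    if "f square_integrable_on \<Omega>" "continuous_on UNIV \<phi>" for f \<phi>
  proof -
    have k_scale: "k (r *\<^sub>R z) = r *\<^sub>R k z" for r z
      using linear_cmul[OF bounded_linear.linear[OF k]] .
    have "k (f x * of_real (\<phi> x)) = k (f x) * of_real (\<phi> x)" for x
      using k_scale[of "\<phi> x" "f x"] unfolding scaleR_conv_of_real by (simp only: mult.commute)
    then have "indicator \<Omega> x *\<^sub>R (k (f x) * of_real (\<phi> x)) = k (indicator \<Omega> x *\<^sub>R (f x * of_real (\<phi> x)))" for x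
      by (simp only: k_scale)
    then show ?thesis
      unfolding set_lebesgue_integral_def
      using integral_bounded_linear[OF k] int[OF that] unfolding set_integrable_def by simp
  qed
  show ?thesis unfolding weak_gradient_def
  proof (intro conjI allI impI square_integrable_bounded_linear[OF K] g)
    fix \<phi> i assume \<phi>: "test_function \<Omega> \<phi>"
    note c = test_function_continuous[OF \<phi>]
    show "set_lebesgue_integral lebesgue \<Omega> (\<lambda>x. k (u x) * of_real (partial i \<phi> x)) =
        - set_lebesgue_integral lebesgue \<Omega> (\<lambda>x. (\<chi> i. k (g x $ i)) $ i * of_real (\<phi> x))"
      using u(2) \<phi> linear_neg[OF bounded_linear.linear[OF k]] unfolding weak_gradient_def
      by (simp add: k_int[OF u(1) c(2)] k_int[OF square_integrable_component[OF g] c(1)])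
  qed
qed

lemma weak_gradient_zero: "weak_gradient \<Omega> 0 (\<lambda>x. 0)"
  by (simp add: weak_gradient_def square_integrable_on_def set_borel_measurable_def
      set_integrable_def set_lebesgue_integral_def)

lemma H1_bounded_linear:
  assumes "open \<Omega>" "bounded \<Omega>" "bounded_linear k" "u \<in> H1 \<Omega>"
  shows "(\<lambda>x. k (u x)) \<in> H1 \<Omega>"
  using assms weak_gradient_bounded_linear[OF assms(1-3)] square_integrable_bounded_linear[OF assms(3)]
  unfolding H1_def by blast

lemma H1_add:
  assumes "open \<Omega>" "bounded \<Omega>" "u \<in> H1 \<Omega>" "v \<in> H1 \<Omega>"
  shows "(\<lambda>x. u x + v x) \<in> H1 \<Omega>"
  using assms weak_gradient_add[OF assms(1,2)] square_integrable_add unfolding H1_def by blast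

lemma H1_zero: "0 \<in> H1 \<Omega>"
  using weak_gradient_zero
  by (auto simp: H1_def square_integrable_on_def set_borel_measurable_def set_integrable_def zero_fun_def)

text \<open>The zero gradient attains the infimum of nonnegative numbers. It serves for constant
  approximating sequences in the definition of a trace.\<close>

lemma H1_norm_zero: "H1_norm \<Omega> 0 = 0"
proof -
  have "(INF g\<in>{g. weak_gradient \<Omega> 0 g}.
     sqrt (set_lebesgue_integral lebesgue \<Omega> (\<lambda>x. (norm ((0::'a field) x))\<^sup>2 + (norm (g x))\<^sup>2))) = 0"
    (is "(INF g\<in>?G. ?f g) = 0")
  proof (rule antisym)
    have nn: "?f g \<ge> 0" for g :: "real ^ 'a \<Rightarrow> complex ^ 'a"
      by (simp add: set_lebesgue_integral_def)
    have "(INF g\<in>?G. ?f g) \<le> ?f (\<lambda>x. 0)"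
      using weak_gradient_zero nn by (intro cINF_lower) (auto intro!: bdd_belowI2[of _ 0])
    then show "(INF g\<in>?G. ?f g) \<le> 0" by (simp add: set_lebesgue_integral_def)
    show "0 \<le> (INF g\<in>?G. ?f g)"
      using weak_gradient_zero nn by (intro cINF_greatest) auto
  qed
  then show ?thesis unfolding H1_norm_def .
qed

section \<open>Restriction, conjugation and piecewise polynomials\<close>

lemma restr_add: "restr \<Theta> (u + v) = restr \<Theta> u + restr \<Theta> v"
  and restr_scaleC: "restr \<Theta> (a *\<^sub>C u) = a *\<^sub>C restr \<Theta> u"
  and restr_conj: "restr \<Theta> (conj_fun u) = conj_fun (restr \<Theta> u)"
  and restr_restr: "restr \<Theta> (restr \<Theta>' u) = restr (\<Theta> \<inter> \<Theta>') u"
  by (auto simp: restr_def conj_fun_def)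

lemma clinear_on_restr: "restr \<Theta> ` V \<subseteq> W \<Longrightarrow> clinear_on V W (restr \<Theta>)"
  unfolding clinear_on_def by (auto simp: restr_add restr_scaleC)

lemma conj_fun_conj_fun [simp]: "conj_fun (conj_fun u) = u"
  by (simp add: conj_fun_def)

lemma conj_fun_zero [simp]: "conj_fun 0 = 0"
  by (auto simp: conj_fun_def)

definition monomial_on :: "(real ^ 'n) set \<Rightarrow> ('n \<Rightarrow> nat) \<Rightarrow> 'n field" where
  "monomial_on E \<alpha> = restr E (\<lambda>x. of_real (\<Prod>i\<in>UNIV. x $ i ^ \<alpha> i))"

lemma finite_multi_indices: "finite {\<alpha> :: 'n::finite \<Rightarrow> nat. (\<Sum>i\<in>UNIV. \<alpha> i) \<le> k}"
proof (rule finite_subset)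
  have "\<alpha> i \<le> sum \<alpha> UNIV" for \<alpha> :: "'n \<Rightarrow> nat" and i
    by (rule member_le_sum) auto
  then show "{\<alpha> :: 'n \<Rightarrow> nat. (\<Sum>i\<in>UNIV. \<alpha> i) \<le> k} \<subseteq> {\<alpha>. \<forall>i. \<alpha> i \<in> {..k}}"
    using order_trans by fastforce
  show "finite {\<alpha> :: 'n \<Rightarrow> nat. \<forall>i. \<alpha> i \<in> {..k}}"
    using finite_set_of_finite_funs[of "UNIV :: 'n set" "{..k}"] by simp
qed

lemma poly_on_add:
  assumes "poly_on k K u" "poly_on k K v"
  shows "poly_on k K (\<lambda>x. u x + v x)"
proof -
  obtain c d where "\<forall>x\<in>K. u x = (\<Sum>\<alpha>\<in>{\<alpha>. sum \<alpha> UNIV \<le> k}. c \<alpha> * of_real (\<Prod>i\<in>UNIV. x $ i ^ \<alpha> i))"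
    "\<forall>x\<in>K. v x = (\<Sum>\<alpha>\<in>{\<alpha>. sum \<alpha> UNIV \<le> k}. d \<alpha> * of_real (\<Prod>i\<in>UNIV. x $ i ^ \<alpha> i))"
    using assms unfolding poly_on_def by blast
  then show ?thesis unfolding poly_on_def
    by (intro exI[of _ "\<lambda>\<alpha>. c \<alpha> + d \<alpha>"]) (simp add: distrib_right sum.distrib)
qed

lemma poly_on_scale:
  assumes "poly_on k K u"
  shows "poly_on k K (\<lambda>x. a * u x)"
proof -
  obtain c where "\<forall>x\<in>K. u x = (\<Sum>\<alpha>\<in>{\<alpha>. sum \<alpha> UNIV \<le> k}. c \<alpha> * of_real (\<Prod>i\<in>UNIV. x $ i ^ \<alpha> i))"
    using assms unfolding poly_on_def by blast
  then show ?thesis unfolding poly_on_def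
    by (intro exI[of _ "\<lambda>\<alpha>. a * c \<alpha>"]) (simp add: sum_distrib_left mult.assoc)
qed

lemma poly_on_cnj:
  assumes "poly_on k K u"
  shows "poly_on k K (\<lambda>x. cnj (u x))"
proof -
  obtain c where "\<forall>x\<in>K. u x = (\<Sum>\<alpha>\<in>{\<alpha>. sum \<alpha> UNIV \<le> k}. c \<alpha> * of_real (\<Prod>i\<in>UNIV. x $ i ^ \<alpha> i))"
    using assms unfolding poly_on_def by blast
  then show ?thesis unfolding poly_on_def
    by (intro exI[of _ "\<lambda>\<alpha>. cnj (c \<alpha>)"]) simp
qed

lemma poly_on_zero: "poly_on k K 0"
  unfolding poly_on_def by (intro exI[of _ "\<lambda>\<alpha>. 0"]) simp

lemma fe_space_subspace:
  assumes \<Omega>: "open \<Omega>" "bounded \<Omega>"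
  shows "complex_vector.subspace (fe_space \<Omega> \<T> k)"
proof (rule complex_vector.subspaceI)
  show "0 \<in> fe_space \<Omega> \<T> k"
    unfolding fe_space_def using H1_zero poly_on_zero
    by (auto simp: zero_fun_def continuous_on_const)
next
  fix u v assume "u \<in> fe_space \<Omega> \<T> k" "v \<in> fe_space \<Omega> \<T> k"
  then show "u + v \<in> fe_space \<Omega> \<T> k"
    unfolding fe_space_def plus_fun_def
    by (auto intro!: H1_add[OF \<Omega>] continuous_intros poly_on_add)
next
  fix a u assume "u \<in> fe_space \<Omega> \<T> k"
  then show "a *\<^sub>C u \<in> fe_space \<Omega> \<T> k"
    unfolding fe_space_def scaleC_fun_def scaleC_complex_def
    by (auto intro!: H1_bounded_linear[OF \<Omega> bounded_linear_mult_right] continuous_intros poly_on_scale)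
qed

lemma fe_space_conj:
  assumes \<Omega>: "open \<Omega>" "bounded \<Omega>" and u: "u \<in> fe_space \<Omega> \<T> k"
  shows "conj_fun u \<in> fe_space \<Omega> \<T> k"
  using u unfolding fe_space_def conj_fun_def
  by (auto intro!: H1_bounded_linear[OF \<Omega> bounded_linear_cnj] continuous_intros poly_on_cnj)

text \<open>A point on several cells is assigned to one of them, so that a piecewise polynomial becomes a
  combination of monomials cut off to disjoint sets.\<close>

lemma fe_space_finitely_spanned:
  assumes \<Omega>: "open \<Omega>" "bounded \<Omega>" and \<T>: "finite \<T>" "closure \<Omega> \<subseteq> \<Union>\<T>"
  shows "finitely_spanned (fe_space \<Omega> \<T> k)"
proof -
  have "\<forall>x\<in>closure \<Omega>. \<exists>K. K \<in> \<T> \<and> x \<in> K" using \<T>(2) by blast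
  then obtain s where s: "\<And>x. x \<in> closure \<Omega> \<Longrightarrow> s x \<in> \<T> \<and> x \<in> s x" by metis
  let ?I = "{\<alpha> :: 'a \<Rightarrow> nat. sum \<alpha> UNIV \<le> k}"
  let ?E = "\<lambda>K. {x\<in>closure \<Omega>. s x = K}"
  let ?G = "(\<lambda>(K, \<alpha>). monomial_on (?E K) \<alpha>) ` (\<T> \<times> ?I)"
  have "v \<in> complex_vector.span ?G" if v: "v \<in> fe_space \<Omega> \<T> k" for v
  proof -
    have "\<forall>K\<in>\<T>. \<exists>c. \<forall>x\<in>K. v x = (\<Sum>\<alpha>\<in>?I. c \<alpha> * of_real (\<Prod>i\<in>UNIV. x $ i ^ \<alpha> i))"
      using v unfolding fe_space_def poly_on_def by blast
    then obtain c where c: "\<And>K x. K \<in> \<T> \<Longrightarrow> x \<in> K \<Longrightarrow>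
        v x = (\<Sum>\<alpha>\<in>?I. c K \<alpha> * of_real (\<Prod>i\<in>UNIV. x $ i ^ \<alpha> i))"
      unfolding bchoice_iff by blast
    have eq: "(\<Sum>K\<in>\<T>. \<Sum>\<alpha>\<in>?I. c K \<alpha> *\<^sub>C monomial_on (?E K) \<alpha>) = v"
    proof
      fix x
      show "(\<Sum>K\<in>\<T>. \<Sum>\<alpha>\<in>?I. c K \<alpha> *\<^sub>C monomial_on (?E K) \<alpha>) x = v x"
      proof (cases "x \<in> closure \<Omega>")
        case True
        have "(\<Sum>K\<in>\<T>. \<Sum>\<alpha>\<in>?I. c K \<alpha> *\<^sub>C monomial_on (?E K) \<alpha>) x
            = (\<Sum>K\<in>\<T>. if K = s x then \<Sum>\<alpha>\<in>?I. c K \<alpha> * of_real (\<Prod>i\<in>UNIV. x $ i ^ \<alpha> i) else 0)"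
          using True by (auto simp: sum_fun_apply monomial_on_def restr_def intro!: sum.cong)
        also have "\<dots> = v x" using \<T>(1) s[OF True] c[of "s x" x] by simp
        finally show ?thesis .
      next
        case False
        then have "v x = 0" using v unfolding fe_space_def by blast
        then show ?thesis using False by (simp add: sum_fun_apply monomial_on_def restr_def)
      qed
    qed
    have "(\<Sum>K\<in>\<T>. \<Sum>\<alpha>\<in>?I. c K \<alpha> *\<^sub>C monomial_on (?E K) \<alpha>) \<in> complex_vector.span ?G"
      by (intro complex_vector.span_sum complex_vector.span_scale complex_vector.span_base) auto
    then show ?thesis unfolding eq .
  qed
  \<comment> \<open>The cut-off monomials are discontinuous in general and need not belong to the
    finite element space; inclusion in their span is enough.\<close>
  then show ?thesis
    using \<T>(1) finite_multi_indices[of k]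
    by (intro finitely_spannedI[where F = ?G] fe_space_subspace[OF \<Omega>]) auto
qed

lemma fe_restr_finitely_spanned:
  assumes "open \<Omega>" "bounded \<Omega>" "finite \<T>" "closure \<Omega> \<subseteq> \<Union>\<T>"
  shows "finitely_spanned (fe_restr \<Omega> \<T> k \<Theta>)"
  unfolding fe_restr_def
  by (rule finitely_spanned_image[OF clinear_on_restr[OF subset_refl] fe_space_finitely_spanned[OF assms]])

lemma fe_restr_conj:
  assumes "open \<Omega>" "bounded \<Omega>" "u \<in> fe_restr \<Omega> \<T> k \<Theta>"
  shows "conj_fun u \<in> fe_restr \<Omega> \<T> k \<Theta>"
  using assms(3) fe_space_conj[OF assms(1,2)] unfolding fe_restr_def
  by (auto simp flip: restr_conj)

lemma restr_fe_restr:
  assumes "\<Theta> \<subseteq> \<Theta>'" "u \<in> fe_restr \<Omega> \<T> k \<Theta>'"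
  shows "restr \<Theta> u \<in> fe_restr \<Omega> \<T> k \<Theta>"
  using assms unfolding fe_restr_def by (auto simp: restr_restr Int_absorb2)

text \<open>A finite element function is continuous up to the boundary, so it serves as its own
  approximation: along the constant sequence both errors in \<open>has_trace\<close> are zero. The
  boundary operator thus applies to discrete traces.\<close>

lemma fe_restr_frontier_subset_H12:
  fixes \<Omega> :: "(real ^ 'n) set"
  shows "fe_restr \<Omega> \<T> k (frontier \<Omega>) \<subseteq> H12 \<Omega>"
proof
  fix g assume "g \<in> fe_restr \<Omega> \<T> k (frontier \<Omega>)"
  then obtain u where u: "u \<in> fe_space \<Omega> \<T> k" and g: "g = restr (frontier \<Omega>) u"
    unfolding fe_restr_def by blast
  have u1: "u \<in> H1 \<Omega>" and uc: "continuous_on (closure \<Omega>) u" using u unfolding fe_space_def by auto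
  have "continuous_on (frontier \<Omega>) u"
    using continuous_on_subset[OF uc, of "frontier \<Omega>"] by (simp add: frontier_def)
  then have "(\<lambda>x. indicator (frontier \<Omega>) x *\<^sub>R u x) \<in> borel_measurable borel"
    by (intro borel_measurable_continuous_on_indicator) auto
  moreover have "g = (\<lambda>x. indicator (frontier \<Omega>) x *\<^sub>R u x)" by (auto simp: g restr_def)
  ultimately have gm: "g \<in> borel_measurable borel" by simp
  have "has_trace \<Omega> u g"
    unfolding has_trace_def
  proof (intro conjI gm exI[of _ "\<lambda>m. u"])
    have "(\<integral>\<^sup>+x\<in>frontier \<Omega>. ennreal ((norm (u x - g x))\<^sup>2) \<partial>surface_measure) = (\<integral>\<^sup>+(x::real^'n). 0 \<partial>surface_measure)"
      by (intro nn_integral_cong) (auto simp: g restr_def indicator_def)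
    then show "(\<lambda>m. \<integral>\<^sup>+x\<in>frontier \<Omega>. ennreal ((norm (u x - g x))\<^sup>2) \<partial>surface_measure) \<longlonglongrightarrow> 0"
      by simp
  qed (use u1 uc in \<open>auto simp: g restr_def H1_norm_zero\<close>)
  then show "g \<in> H12 \<Omega>" unfolding H12_def using u1 by blast
qed

section \<open>The Helmholtz form on finite element functions\<close>

text \<open>\<open>p\<close> and \<open>dp i\<close> are continuous on the whole space, hence
  bounded on every bounded \<open>E\<close>, up to its boundary. The derivative is required of
  \<open>u\<close> itself, as \<open>partial\<close> is evaluated on \<open>u\<close>.\<close>

definition smooth_piece :: "(real ^ 'n) set \<Rightarrow> 'n field \<Rightarrow> bool" where
  "smooth_piece E u \<longleftrightarrow> (\<exists>p dp. continuous_on UNIV p \<and> (\<forall>i. continuous_on UNIV (dp i)) \<and>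
     (\<forall>x\<in>E. u x = p x \<and>
        (\<forall>i. ((\<lambda>t. u (x + t *\<^sub>R axis i 1)) has_vector_derivative dp i x) (at 0))))"

text \<open>Only the factor with index \<open>i\<close> varies along the line. If
  \<open>\<alpha> i = 0\<close>, the truncated exponent \<open>\<alpha> i - 1\<close> does no harm,
  because the coefficient is zero.\<close>

lemma monomial_has_partial_derivative:
  fixes \<alpha> :: "'n::finite \<Rightarrow> nat" and x :: "real ^ 'n"
  shows "((\<lambda>t. \<Prod>j\<in>UNIV. (x + t *\<^sub>R axis i 1) $ j ^ \<alpha> j) has_real_derivative
     real (\<alpha> i) * x $ i ^ (\<alpha> i - 1) * (\<Prod>j\<in>UNIV - {i}. x $ j ^ \<alpha> j)) (at 0)"
proof -
  have eq: "(\<lambda>t. \<Prod>j\<in>UNIV. (x + t *\<^sub>R axis i 1) $ j ^ \<alpha> j)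
      = (\<lambda>t. (x $ i + t) ^ \<alpha> i * (\<Prod>j\<in>UNIV - {i}. x $ j ^ \<alpha> j))"
    by (rule ext, subst prod.remove[of UNIV i]) (auto simp: axis_def intro!: prod.cong)
  show ?thesis unfolding eq by (auto intro!: derivative_eq_intros)
qed

lemma poly_on_smooth_piece:
  fixes v :: "'n::finite field"
  assumes v: "poly_on k K v" and E: "open E" "E \<subseteq> K" and u: "\<And>x. x \<in> E \<Longrightarrow> u x = v x"
  shows "smooth_piece E u"
proof -
  let ?I = "{\<alpha> :: 'n \<Rightarrow> nat. sum \<alpha> UNIV \<le> k}"
  obtain c where c: "\<And>x. x \<in> K \<Longrightarrow> v x = (\<Sum>\<alpha>\<in>?I. c \<alpha> * of_real (\<Prod>i\<in>UNIV. x $ i ^ \<alpha> i))"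
    using v unfolding poly_on_def by blast
  define p where "p x = (\<Sum>\<alpha>\<in>?I. c \<alpha> * of_real (\<Prod>i\<in>UNIV. x $ i ^ \<alpha> i))" for x :: "real ^ 'n"
  define dp where "dp i x = (\<Sum>\<alpha>\<in>?I. c \<alpha> * of_real (real (\<alpha> i) * x $ i ^ (\<alpha> i - 1) *
      (\<Prod>j\<in>UNIV - {i}. x $ j ^ \<alpha> j)))" for i and x :: "real ^ 'n"
  have up: "u x = p x" if "x \<in> E" for x using u[OF that] c[of x] E(2) that unfolding p_def by auto
  have "continuous_on UNIV p" "\<And>i. continuous_on UNIV (dp i)"
    unfolding p_def dp_def by (intro continuous_intros)+
  moreover have "((\<lambda>t. u (x + t *\<^sub>R axis i 1)) has_vector_derivative dp i x) (at 0)" if x: "x \<in> E" for x i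
  proof -
    \<comment> \<open>These are the parameters at which the line through \<open>x\<close> stays in
      \<open>E\<close>; near zero \<open>u\<close> agrees with the polynomial along it.\<close>
    let ?S = "(\<lambda>t. x + t *\<^sub>R axis i 1) -` E"
    have "open ?S" by (intro open_vimage E(1) continuous_intros)
    moreover have "((\<lambda>t. p (x + t *\<^sub>R axis i 1)) has_vector_derivative dp i x) (at 0)"
      unfolding p_def dp_def
      by (intro has_vector_derivative_sum has_vector_derivative_mult_right
          has_vector_derivative_of_real monomial_has_partial_derivative)
    ultimately show ?thesis
      using x up by (elim has_vector_derivative_transform_within_open) auto
  qed
  ultimately show ?thesis unfolding smooth_piece_def using up by blast
qed

text \<open>\<open>m\<close> will be the squared wave number, which is only essentially bounded, or
  the constant one for the gradient term.\<close>

lemma set_integrable_bounded_times_continuous: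
  fixes g :: "real ^ 'n \<Rightarrow> complex"
  assumes G: "open G" "bounded G" and g: "continuous_on UNIV g"
    and m: "m \<in> borel_measurable lebesgue" "AE x in lebesgue. cmod (m x) \<le> C"
  shows "set_integrable lebesgue G (\<lambda>x. m x * g x)"
proof -
  have "compact (g ` closure G)"
    using G g by (intro compact_continuous_image) (auto intro: continuous_on_subset)
  from compact_imp_bounded[OF this] obtain B where B: "\<And>x. x \<in> closure G \<Longrightarrow> cmod (g x) \<le> B"
    unfolding bounded_iff by auto
  have gm: "g \<in> borel_measurable lebesgue"
    by (intro measurable_completion) (use borel_measurable_continuous_onI[OF g] in simp)
  have "AE x in lebesgue. x \<in> G \<longrightarrow> norm (m x * g x) \<le> C * B"
    using m(2)
  proof eventually_elim
    case (elim x)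
    have "cmod (m x) * cmod (g x) \<le> C * B" if "x \<in> G"
      using elim B[of x] closure_subset that by (intro mult_mono) (auto intro: order_trans[OF norm_ge_zero])
    then show ?case by (simp add: norm_mult)
  qed
  then show ?thesis
    using lmeasurable_open[OF G(2,1)] m(1) gm unfolding set_integrable_def fmeasurable_def
    by (intro integrableI_bounded_set_indicator) auto
qed

text \<open>\<open>D\<close> will be a single subdomain and \<open>\<T>\<close> the whole mesh:
  cells are intersected with \<open>D\<close>, so no submesh has to be selected.\<close>

locale cell_domain =
  fixes \<T> :: "(real ^ 'n) set set" and D :: "(real ^ 'n) set" and \<kappa> :: "real ^ 'n \<Rightarrow> complex"
    and C :: real
  assumes cells: "finite \<T>" "\<And>K. K \<in> \<T> \<Longrightarrow> polytope K" and D: "open D" "D \<subseteq> \<Union>\<T>"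
    and \<kappa>: "\<kappa> \<in> borel_measurable lebesgue" "AE x in lebesgue. cmod (\<kappa> x) \<le> C"
begin

definition E :: "(real ^ 'n) set" where
  "E = (\<Union>K\<in>\<T>. interior K \<inter> D)"

definition pieces :: "'n field \<Rightarrow> bool" where
  "pieces u \<longleftrightarrow> (\<forall>K\<in>\<T>. smooth_piece (interior K \<inter> D) u)"

abbreviation integrand :: "'n field \<Rightarrow> 'n field \<Rightarrow> real ^ 'n \<Rightarrow> complex" where
  "integrand u v \<equiv> \<lambda>x. (\<Sum>i\<in>UNIV. partial i u x * partial i v x) - (\<kappa> x)\<^sup>2 * u x * v x"

lemma piece: "K \<in> \<T> \<Longrightarrow> open (interior K \<inter> D)" "K \<in> \<T> \<Longrightarrow> bounded (interior K \<inter> D)"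
  using D(1) cells(2) polytope_imp_bounded by (auto intro: bounded_subset[OF bounded_interior])

text \<open>\<open>vector_derivative\<close> is a choice operator; this lemma ties it to an actual
  derivative on the open cells, so that the rules for sums, multiples and conjugates apply.\<close>

lemma partial_derivative:
  assumes "pieces u" "x \<in> E"
  shows "((\<lambda>t. u (x + t *\<^sub>R axis i 1)) has_vector_derivative partial i u x) (at 0)"
proof -
  obtain K where K: "K \<in> \<T>" "x \<in> interior K \<inter> D" using assms(2) unfolding E_def by blast
  then obtain d where "((\<lambda>t. u (x + t *\<^sub>R axis i 1)) has_vector_derivative d) (at 0)"
    using assms(1) unfolding pieces_def smooth_piece_def by blast
  then show ?thesis using vector_derivative_at unfolding partial_def by metis
qed

text \<open>On each cell the functions and their partial derivatives are replaced by globally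
  continuous ones, which leaves bounded integrands on a bounded set; there are finitely many
  cells.\<close>

lemma integrand_integrable:
  assumes u: "pieces u" and v: "pieces v"
  shows "set_integrable lebesgue E (integrand u v)"
  unfolding E_def
proof (rule set_integrable_UN[OF cells(1)])
  fix K assume K: "K \<in> \<T>"
  let ?G = "interior K \<inter> D"
  note G = piece[OF K]
  show "?G \<in> sets lebesgue" using lmeasurable_open[OF G(2,1)] by (rule fmeasurableD)
  obtain p dp where p: "continuous_on UNIV p" "\<And>i. continuous_on UNIV (dp i)"
    "\<And>x. x \<in> ?G \<Longrightarrow> u x = p x"
    "\<And>x i. x \<in> ?G \<Longrightarrow> ((\<lambda>t. u (x + t *\<^sub>R axis i 1)) has_vector_derivative dp i x) (at 0)"
    using u K unfolding pieces_def smooth_piece_def by blast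
  obtain q dq where q: "continuous_on UNIV q" "\<And>i. continuous_on UNIV (dq i)"
    "\<And>x. x \<in> ?G \<Longrightarrow> v x = q x"
    "\<And>x i. x \<in> ?G \<Longrightarrow> ((\<lambda>t. v (x + t *\<^sub>R axis i 1)) has_vector_derivative dq i x) (at 0)"
    using v K unfolding pieces_def smooth_piece_def by blast
  have d: "partial i u x = dp i x" "partial i v x = dq i x" if "x \<in> ?G" for i x
    using vector_derivative_at[OF p(4)[OF that]] vector_derivative_at[OF q(4)[OF that]]
    unfolding partial_def by auto
  have 1: "set_integrable lebesgue ?G (\<lambda>x. 1 * (\<Sum>i\<in>UNIV. dp i x * dq i x))"
    by (rule set_integrable_bounded_times_continuous[OF G, where C = 1])
      (auto intro!: continuous_intros p q)
  have "AE x in lebesgue. cmod ((\<kappa> x)\<^sup>2) \<le> C\<^sup>2"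
    using \<kappa>(2) by eventually_elim (auto simp: norm_power intro: power_mono)
  then have 2: "set_integrable lebesgue ?G (\<lambda>x. (\<kappa> x)\<^sup>2 * (p x * q x))"
    using \<kappa>(1) p q
    by (intro set_integrable_bounded_times_continuous[OF G, where C = "C\<^sup>2"] continuous_intros) auto
  have "set_integrable lebesgue ?G (\<lambda>x. 1 * (\<Sum>i\<in>UNIV. dp i x * dq i x) - (\<kappa> x)\<^sup>2 * (p x * q x))"
    using set_integral_diff(1)[OF 1 2] .
  then show "set_integrable lebesgue ?G (integrand u v)"
    by (subst set_integrable_cong[OF refl refl]) (auto simp: d p(3) q(3) mult.assoc)
qed

lemma E_sets: "E \<in> sets lebesgue"
  unfolding E_def using cells(1) piece by (intro sets.finite_UN) (auto intro: fmeasurableD lmeasurable_open)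

text \<open>A point of \<open>D\<close> outside all open cells lies on the frontier of a cell, and
  frontiers of convex sets are null. Replacing \<open>D\<close> by \<open>E\<close> removes the
  points where pointwise derivatives may fail to exist.\<close>

lemma helmholtz_form_eq:
  assumes "pieces u" "pieces v"
  shows "helmholtz_form \<kappa> D u v = set_lebesgue_integral lebesgue E (integrand u v)"
proof -
  have "E \<subseteq> D" unfolding E_def by blast
  moreover have "negligible (D - E)"
  proof (rule negligible_subset)
    show "negligible (\<Union>K\<in>\<T>. frontier K)"
      using cells polytope_imp_convex by (intro negligible_Union) (auto intro: negligible_convex_frontier)
    show "D - E \<subseteq> (\<Union>K\<in>\<T>. frontier K)"
    proof
      fix x assume x: "x \<in> D - E"
      then obtain K where "K \<in> \<T>" "x \<in> K" using D(2) by blast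
      then show "x \<in> (\<Union>K\<in>\<T>. frontier K)"
        using x closure_subset[of K] unfolding E_def frontier_def by auto
    qed
  qed
  ultimately have 1: "integral E f = integral D f" for f :: "real ^ 'n \<Rightarrow> complex"
    by (rule integral_subset_negligible)
  have neg: "negligible (D - E)" by fact
  have "{x \<in> E - D. integrand u v x \<noteq> 0} = {}" using \<open>E \<subseteq> D\<close> by blast
  then have "set_integrable lebesgue D (integrand u v)"
    using integrand_integrable[OF assms] neg
    by (subst absolutely_integrable_spike_set_eq[where T = E])
      (auto intro: negligible_subset)
  from set_lebesgue_integral_eq_integral(2)[OF this] show ?thesis
    unfolding helmholtz_form_def 1[symmetric]
      set_lebesgue_integral_eq_integral(2)[OF integrand_integrable[OF assms]] .
qed

section \<open>Symmetry, linearity and dissipativity of the Helmholtz form\<close>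

lemma helmholtz_form_commute: "helmholtz_form \<kappa> D u v = helmholtz_form \<kappa> D v u"
  unfolding helmholtz_form_def by (simp add: mult.commute mult.left_commute)

lemma partial_add:
  assumes "pieces u" "pieces v" "x \<in> E"
  shows "partial i (u + v) x = partial i u x + partial i v x"
  using vector_derivative_at[OF has_vector_derivative_add[OF partial_derivative[OF assms(1,3)]
        partial_derivative[OF assms(2,3)]]]
  unfolding partial_def by simp

lemma partial_scale:
  assumes "pieces u" "x \<in> E"
  shows "partial i (a *\<^sub>C u) x = a * partial i u x"
  using vector_derivative_at[OF has_vector_derivative_mult_right[OF partial_derivative[OF assms]]]
  unfolding partial_def by simp

lemma partial_conj:
  assumes "pieces u" "x \<in> E"
  shows "partial i (conj_fun u) x = cnj (partial i u x)"
  using vector_derivative_at[OF has_vector_derivative_cnj[OF partial_derivative[OF assms]]]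
  unfolding partial_def conj_fun_def by simp

text \<open>The sum is required to be piecewise smooth as well because the integral of each form is
  first moved to \<open>E\<close>; in the application it belongs to the same finite element
  space.\<close>

lemma helmholtz_form_add:
  assumes "pieces u" "pieces v" "pieces (u + v)" "pieces w"
  shows "helmholtz_form \<kappa> D (u + v) w = helmholtz_form \<kappa> D u w + helmholtz_form \<kappa> D v w"
proof -
  have "set_lebesgue_integral lebesgue E (integrand (u + v) w)
      = set_lebesgue_integral lebesgue E (\<lambda>x. integrand u w x + integrand v w x)"
    by (intro set_lebesgue_integral_cong E_sets)
      (auto simp: partial_add[OF assms(1,2)] algebra_simps sum.distrib)
  then show ?thesis
    using assms set_integral_add(2)[OF integrand_integrable integrand_integrable, of u w v w]
    by (simp add: helmholtz_form_eq)
qed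

lemma helmholtz_form_scale:
  assumes "pieces u" "pieces (a *\<^sub>C u)" "pieces w"
  shows "helmholtz_form \<kappa> D (a *\<^sub>C u) w = a * helmholtz_form \<kappa> D u w"
proof -
  have "set_lebesgue_integral lebesgue E (integrand (a *\<^sub>C u) w)
      = set_lebesgue_integral lebesgue E (\<lambda>x. a * integrand u w x)"
    by (intro set_lebesgue_integral_cong E_sets)
      (auto simp: partial_scale[OF assms(1)] algebra_simps sum_distrib_left)
  then show ?thesis using assms by (simp add: helmholtz_form_eq)
qed

text \<open>Against its own conjugate the gradient term is a real sum of squares, so the imaginary
  part of the integrand is minus that of the squared wave number times the squared modulus of
  \<open>u\<close>.\<close>

lemma helmholtz_form_dissipative:
  assumes "pieces u" "pieces (conj_fun u)" and \<kappa>_Im: "\<And>x. Im ((\<kappa> x)\<^sup>2) \<ge> 0"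
  shows "Im (helmholtz_form \<kappa> D u (conj_fun u)) \<le> 0"
proof -
  note int = integrand_integrable[OF assms(1,2)]
  let ?f = "integrand u (conj_fun u)"
  have conj_apply: "conj_fun u x = cnj (u x)" for x by (simp add: conj_fun_def)
  have "Im (set_lebesgue_integral lebesgue E ?f) = (LINT x|lebesgue. Im (indicator E x *\<^sub>R ?f x))"
    using int unfolding set_lebesgue_integral_def set_integrable_def by (rule integral_Im[symmetric])
  also have "\<dots> \<le> 0"
  proof -
    have "Im (?f x) \<le> 0" if x: "x \<in> E" for x
    proof -
      have "?f x = of_real (\<Sum>i\<in>UNIV. (cmod (partial i u x))\<^sup>2) - (\<kappa> x)\<^sup>2 * of_real ((cmod (u x))\<^sup>2)"
        by (simp add: partial_conj[OF assms(1) x] conj_apply complex_norm_square mult.assoc del: of_real_power)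
      then have "Im (?f x) = - (Im ((\<kappa> x)\<^sup>2) * (cmod (u x))\<^sup>2)"
        by (simp del: of_real_sum of_real_power)
      then show ?thesis using \<kappa>_Im[of x] by simp
    qed
    then have "0 \<le> (LINT x|lebesgue. - Im (indicator E x *\<^sub>R ?f x))"
      by (intro Bochner_Integration.integral_nonneg) (auto simp: indicator_def)
    then show ?thesis by simp
  qed
  finally show ?thesis using assms by (simp add: helmholtz_form_eq)
qed

text \<open>On an open cell inside \<open>D\<close> the cut-off to the closure of \<open>D\<close>
  has no effect, so the function is a polynomial there.\<close>

lemma pieces_fe_restr:
  assumes "u \<in> fe_restr \<Omega> \<T> k (closure D)"
  shows "pieces u"
  unfolding pieces_def
proof
  fix K assume K: "K \<in> \<T>"
  obtain v where v: "v \<in> fe_space \<Omega> \<T> k" "u = restr (closure D) v"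
    using assms unfolding fe_restr_def by blast
  then have "poly_on k K v" using K unfolding fe_space_def by blast
  then show "smooth_piece (interior K \<inter> D) u"
  proof (rule poly_on_smooth_piece)
    show "interior K \<inter> D \<subseteq> K" using interior_subset by blast
    show "u x = v x" if "x \<in> interior K \<inter> D" for x
      using that v(2) closure_subset[of D] by (auto simp: restr_def)
  qed (use piece[OF K] in blast)
qed

end

section \<open>The operators of the domain decomposition\<close>

lemma subspace_Times:
  "complex_vector.subspace U \<Longrightarrow> complex_vector.subspace V \<Longrightarrow> complex_vector.subspace (U \<times> V)"
  by (intro complex_vector.subspaceI)
    (auto simp: zero_prod_def scaleC_prod_def subspace_0 subspace_add subspace_scale)

lemma subspace_Pi:
  "(\<And>j. complex_vector.subspace (V j)) \<Longrightarrow> complex_vector.subspace {u. \<forall>j. u j \<in> V j}"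
  by (intro complex_vector.subspaceI) (auto simp: subspace_0 subspace_add subspace_scale)

lemma trace_op_linear:
  "clinear_on (broken_space \<Omega> \<T> k Qh \<Omega>s) (multitrace_space \<Omega> \<T> k \<Omega>s) (trace_op \<Omega>s)"
proof (rule clinear_onI)
  fix u assume "u \<in> broken_space \<Omega> \<T> k Qh \<Omega>s"
  then show "trace_op \<Omega>s u \<in> multitrace_space \<Omega> \<T> k \<Omega>s"
    unfolding broken_space_def multitrace_space_def trace_op_def
    by (auto simp: frontier_def intro!: restr_fe_restr[OF Diff_subset])
qed (simp_all add: trace_op_def restr_add restr_scaleC prod_eq_iff fun_eq_iff)

lemma restr_op_linear:
  "clinear_on (fe_restr \<Omega> \<T> k (skeleton \<Omega> \<Omega>s)) (multitrace_space \<Omega> \<T> k \<Omega>s) (restr_op \<Omega> \<Omega>s)"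
proof (rule clinear_onI)
  fix u assume "u \<in> fe_restr \<Omega> \<T> k (skeleton \<Omega> \<Omega>s)"
  then show "restr_op \<Omega> \<Omega>s u \<in> multitrace_space \<Omega> \<T> k \<Omega>s"
    unfolding multitrace_space_def restr_op_def skeleton_def
    by (auto intro: restr_fe_restr[rotated])
qed (simp_all add: restr_op_def restr_add restr_scaleC prod_eq_iff fun_eq_iff)

lemma restr_op_conj: "restr_op \<Omega> \<Omega>s (conj_fun u) = conj_multitrace (restr_op \<Omega> \<Omega>s u)"
  by (simp add: restr_op_def conj_multitrace_def restr_conj)

text \<open>In the second argument one summand is an evaluation of \<open>\<phi>\<close> and the
  other an evaluation at the fixed \<open>g\<close>; only the first needs linearity of a functional.
  In the first argument the roles are exchanged.\<close>

lemma boundary_pairing_linear_right: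
  assumes "\<phi> \<in> cdual H" "v \<in> H" "w \<in> H"
  shows "boundary_pairing (\<phi>, g) ((v, q) + (w, r)) = boundary_pairing (\<phi>, g) (v, q) + boundary_pairing (\<phi>, g) (w, r)"
    and "boundary_pairing (\<phi>, g) (a *\<^sub>C (v, q)) = a * boundary_pairing (\<phi>, g) (v, q)"
  using assms by (simp_all add: boundary_pairing_def cdual_add cdual_scale algebra_simps)

lemma boundary_pairing_linear_left:
  assumes "q \<in> cdual H" "g \<in> H" "h \<in> H"
  shows "boundary_pairing ((\<phi>, g) + (\<psi>, h)) (v, q) = boundary_pairing (\<phi>, g) (v, q) + boundary_pairing (\<psi>, h) (v, q)"
    and "boundary_pairing (a *\<^sub>C (\<phi>, g)) (v, q) = a * boundary_pairing (\<phi>, g) (v, q)"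
  using assms by (simp_all add: boundary_pairing_def cdual_add cdual_scale algebra_simps)

text \<open>Linearity of the Helmholtz forms is asked in the first argument and transferred to the
  second by \<open>commute\<close>. The boundary block is not symmetric in general, so its two
  arguments are treated separately.\<close>

lemma diag_op_linear:
  fixes \<Omega>s :: "'j::finite \<Rightarrow> (real ^ 'n) set"
  assumes V: "complex_vector.subspace V"
    and \<A>: "clinear_on (H \<times> Q) (Q \<times> H) \<A>" and Q: "Q \<subseteq> cdual H"
    and VHQ: "\<And>v. v \<in> V \<Longrightarrow> fst v \<in> H \<times> Q"
    and add: "\<And>u v w j. u \<in> V \<Longrightarrow> v \<in> V \<Longrightarrow> w \<in> V \<Longrightarrow>
      helmholtz_form \<kappa> (\<Omega>s j) (snd u j + snd v j) (snd w j)
        = helmholtz_form \<kappa> (\<Omega>s j) (snd u j) (snd w j) + helmholtz_form \<kappa> (\<Omega>s j) (snd v j) (snd w j)"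
    and scale: "\<And>u w a j. u \<in> V \<Longrightarrow> w \<in> V \<Longrightarrow>
      helmholtz_form \<kappa> (\<Omega>s j) (a *\<^sub>C snd u j) (snd w j) = a * helmholtz_form \<kappa> (\<Omega>s j) (snd u j) (snd w j)"
    and commute: "\<And>u w j. helmholtz_form \<kappa> (\<Omega>s j) u w = helmholtz_form \<kappa> (\<Omega>s j) w u"
  shows "clinear_on V (cdual V) (diag_op V \<A> \<kappa> \<Omega>s)"
proof (rule clinear_onI)
  have q: "snd (fst v) \<in> cdual H" and v: "fst (fst v) \<in> H" if "v \<in> V" for v
    using VHQ[OF that] Q by (auto simp: mem_Times_iff)
  have \<A>_Q: "fst (\<A> (fst u)) \<in> cdual H" and \<A>_H: "snd (\<A> (fst u)) \<in> H" if "u \<in> V" for u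
    using clinear_on_mem[OF \<A> VHQ[OF that]] Q by (auto simp: mem_Times_iff)
  fix u assume u: "u \<in> V"
  show "diag_op V \<A> \<kappa> \<Omega>s u \<in> cdual V"
  proof (rule cdualI)
    fix w a assume w: "w \<in> V"
    have "helmholtz_form \<kappa> (\<Omega>s j) (snd u j) (a *\<^sub>C snd w j) = a * helmholtz_form \<kappa> (\<Omega>s j) (snd u j) (snd w j)" for j
      using scale[OF w u, where a = a] commute by metis
    then show "diag_op V \<A> \<kappa> \<Omega>s u (a *\<^sub>C w) = a * diag_op V \<A> \<kappa> \<Omega>s u w"
      using w subspace_scale[OF V w]
        boundary_pairing_linear_right(2)[OF \<A>_Q[OF u] v[OF w] v[OF w], of "snd (\<A> (fst u))" a "snd (fst w)"]
      by (simp add: diag_op_def sum_distrib_left distrib_left)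
  next
    fix w x assume w: "w \<in> V" and x: "x \<in> V"
    have "helmholtz_form \<kappa> (\<Omega>s j) (snd u j) (snd w j + snd x j)
        = helmholtz_form \<kappa> (\<Omega>s j) (snd u j) (snd w j) + helmholtz_form \<kappa> (\<Omega>s j) (snd u j) (snd x j)" for j
      using add[OF w x u] commute by metis
    then show "diag_op V \<A> \<kappa> \<Omega>s u (w + x) = diag_op V \<A> \<kappa> \<Omega>s u w + diag_op V \<A> \<kappa> \<Omega>s u x"
      using w x subspace_add[OF V w x]
        boundary_pairing_linear_right(1)[OF \<A>_Q[OF u] v[OF w] v[OF x], of "snd (\<A> (fst u))" "snd (fst w)" "snd (fst x)"]
      by (simp add: diag_op_def sum.distrib)
  qed (simp add: diag_op_def)
  show "diag_op V \<A> \<kappa> \<Omega>s (a *\<^sub>C u) = a *\<^sub>C diag_op V \<A> \<kappa> \<Omega>s u" for a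
  proof
    fix w
    show "diag_op V \<A> \<kappa> \<Omega>s (a *\<^sub>C u) w = (a *\<^sub>C diag_op V \<A> \<kappa> \<Omega>s u) w"
    proof (cases "w \<in> V")
      case w: True
      show ?thesis
        using w u clinear_on_scale[OF \<A> VHQ[OF u], of a]
          boundary_pairing_linear_left(2)[OF q[OF w] \<A>_H[OF u] \<A>_H[OF u], of a "fst (\<A> (fst u))" "fst (fst w)"]
        by (simp add: diag_op_def sum_distrib_left distrib_left scale)
    qed (simp add: diag_op_def)
  qed
  fix x assume x: "x \<in> V"
  show "diag_op V \<A> \<kappa> \<Omega>s (u + x) = diag_op V \<A> \<kappa> \<Omega>s u + diag_op V \<A> \<kappa> \<Omega>s x"
  proof
    fix w
    show "diag_op V \<A> \<kappa> \<Omega>s (u + x) w = (diag_op V \<A> \<kappa> \<Omega>s u + diag_op V \<A> \<kappa> \<Omega>s x) w"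
    proof (cases "w \<in> V")
      case w: True
      show ?thesis
        using w u x clinear_on_add[OF \<A> VHQ[OF u] VHQ[OF x]]
          boundary_pairing_linear_left(1)[OF q[OF w] \<A>_H[OF u] \<A>_H[OF x],
            of "fst (\<A> (fst u))" "fst (\<A> (fst x))" "fst (fst w)"]
        by (simp add: diag_op_def sum.distrib add)
    qed (simp add: diag_op_def)
  qed
qed

theorem mainTheorem4:
  fixes \<Omega> :: "(real ^ 'n) set"
    and \<T> :: "(real ^ 'n) set set"
    and \<Omega>s :: "'j::finite \<Rightarrow> (real ^ 'n) set"
    and k :: nat
    and \<kappa> :: "real ^ 'n \<Rightarrow> complex"
    and k0 :: real
    and \<A> :: "'n field \<times> ('n field \<Rightarrow> complex) \<Rightarrow> ('n field \<Rightarrow> complex) \<times> 'n field"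
    and Qh :: "('n field \<Rightarrow> complex) set"
    and ip :: "('n field \<times> ('n field \<Rightarrow> complex)) \<times> ('j \<Rightarrow> 'n field) \<Rightarrow>
               ('n field \<times> ('n field \<Rightarrow> complex)) \<times> ('j \<Rightarrow> 'n field) \<Rightarrow> complex"
    and T :: "'n field \<times> ('j \<Rightarrow> 'n field) \<Rightarrow> 'n field \<times> ('j \<Rightarrow> 'n field) \<Rightarrow> complex"
  assumes dim: "CARD('n) = 2 \<or> CARD('n) = 3"
    and Omega: "polyhedral_open \<Omega>"
    and kappa_meas: "\<kappa> \<in> borel_measurable lebesgue"
    and kappa_bdd: "\<exists>C. AE x in lebesgue. cmod (\<kappa> x) \<le> C"
    and kappa_Im: "\<forall>x\<in>\<Omega>. Im ((\<kappa> x)\<^sup>2) \<ge> 0"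
    and kappa_out: "k0 > 0" "\<forall>x. x \<notin> \<Omega> \<longrightarrow> \<kappa> x = of_real k0"
    and boundary_op: "bounded_boundary_op \<Omega> \<A>"
    and mesh: "simplicial_mesh \<Omega> \<T>"
    and degree: "k \<ge> 1"
    and Qh: "Qh \<subseteq> Hm12 \<Omega>" "\<exists>F. finite F \<and> Qh = complex_vector.span F"
    and decomposition: "domain_decomposition \<Omega> \<T> \<Omega>s"
    and V: "V = broken_space \<Omega> \<T> k Qh \<Omega>s"
    and W: "W = multitrace_space \<Omega> \<T> k \<Omega>s"
    and B: "B = trace_op \<Omega>s"
    and Bs: "Bs = adjoint_on V B"
    and A: "A = diag_op V \<A> \<kappa> \<Omega>s"
    and T: "impedance_op W conj_multitrace T"
    and Pex: "Pex = exchange_op (fe_restr \<Omega> \<T> k (skeleton \<Omega> \<Omega>s)) (restr_op \<Omega> \<Omega>s) T"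
    and ip: "inner_product_on V ip"
    and M: "M = impedance_problem_op V A B T"
    and Mp: "Mp = pseudo_inverse V ip M"
    and S: "S = scattering_op V ip A B T"
    and ab: "bij_betw M V (cdual V) \<or>
      (conj_dual conj_fun ` Qh \<subseteq> Qh \<and>
       (\<forall>v\<in>H12 \<Omega>. \<forall>q\<in>Hm12 \<Omega>.
          Im (boundary_pairing (\<A> (v, q)) (conj_fun v, conj_dual conj_fun q)) \<le> 0))"
    and l: "l \<in> {A u + Bs p | u p. u \<in> V \<and> p \<in> cdual W}"
  shows
    "(\<forall>u\<in>V. \<forall>p\<in>cdual W.
        A u - Bs p = l \<and> - p + \<i> *\<^sub>C T (B u) = Pex (p + \<i> *\<^sub>C T (B u)) \<longrightarrow>
        (let q = p - \<i> *\<^sub>C T (B u)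
         in q \<in> cdual W \<and> q + Pex (S q) = - ((2 * \<i>) *\<^sub>C Pex (T (B (Mp l)))))) \<and>
     (\<forall>q\<in>cdual W.
        q + Pex (S q) = - ((2 * \<i>) *\<^sub>C Pex (T (B (Mp l)))) \<longrightarrow>
        (let u = Mp (Bs q + l); p = (1 / 2) *\<^sub>C (q - Pex q)
         in u \<in> V \<and> p \<in> cdual W \<and>
            A u - Bs p = l \<and> - p + \<i> *\<^sub>C T (B u) = Pex (p + \<i> *\<^sub>C T (B u))))"
proof -
  note \<Omega> = polyhedral_open_imp[OF Omega]
  have \<T>: "finite \<T>" "closure \<Omega> = \<Union>\<T>"
    using mesh unfolding simplicial_mesh_def triangulation_def by auto
  have \<T>_polytope: "polytope K" if "K \<in> \<T>" for K
    using mesh that simplex_imp_polytope unfolding simplicial_mesh_def by blast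
  obtain C where C: "AE x in lebesgue. cmod (\<kappa> x) \<le> C" using kappa_bdd by blast
  have cell_domain: "cell_domain \<T> (\<Omega>s j) \<kappa> C" for j
  proof
    have "polyhedral_open (\<Omega>s j)" and "closure (\<Omega>s j) \<subseteq> \<Union>\<T>"
      using decomposition unfolding domain_decomposition_def by blast+
    then show "open (\<Omega>s j)" "\<Omega>s j \<subseteq> \<Union>\<T>"
      using polyhedral_open_imp(1) closure_subset by blast+
  qed (use \<T> \<T>_polytope kappa_meas C in auto)
  have fe: "finitely_spanned (fe_restr \<Omega> \<T> k \<Theta>)" for \<Theta>
    using fe_restr_finitely_spanned[OF \<Omega> \<T>(1)] \<T>(2) by simp
  note fe_sub = finitely_spanned_subspace[OF fe]
  have Vf: "finitely_spanned V"
    unfolding V broken_space_def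
    using Qh(2) by (intro finitely_spanned_Times finitely_spanned_Pi fe) (simp add: finitely_spanned_def)
  have Ws: "complex_vector.subspace W"
    unfolding W multitrace_space_def by (intro subspace_Times subspace_Pi fe_sub)
  have Bl: "clinear_on V W B" unfolding V W B by (rule trace_op_linear)
  have V_piece: "snd u j \<in> fe_restr \<Omega> \<T> k (closure (\<Omega>s j))" if "u \<in> V" for u j
    using that unfolding V broken_space_def by auto
  have V_boundary: "fst u \<in> H12 \<Omega> \<times> Hm12 \<Omega>" if "u \<in> V" for u
    using that Qh(1) fe_restr_frontier_subset_H12[of \<Omega> \<T> k] unfolding V broken_space_def by auto
  note pieces = cell_domain.pieces_fe_restr[OF cell_domain V_piece]
  have Al: "clinear_on V (cdual V) A"
    unfolding A
  proof (rule diag_op_linear[where H = "H12 \<Omega>" and Q = "Hm12 \<Omega>"])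
    show "clinear_on (H12 \<Omega> \<times> Hm12 \<Omega>) (Hm12 \<Omega> \<times> H12 \<Omega>) \<A>"
      using boundary_op unfolding bounded_boundary_op_def by blast
    show "Hm12 \<Omega> \<subseteq> cdual (H12 \<Omega>)" unfolding Hm12_def by blast
    show "helmholtz_form \<kappa> (\<Omega>s j) (snd u j + snd v j) (snd w j)
        = helmholtz_form \<kappa> (\<Omega>s j) (snd u j) (snd w j) + helmholtz_form \<kappa> (\<Omega>s j) (snd v j) (snd w j)"
      if "u \<in> V" "v \<in> V" "w \<in> V" for u v w j
      using that subspace_add[OF fe_sub V_piece V_piece]
      by (intro cell_domain.helmholtz_form_add[OF cell_domain] pieces
          cell_domain.pieces_fe_restr[OF cell_domain])
    show "helmholtz_form \<kappa> (\<Omega>s j) (a *\<^sub>C snd u j) (snd w j) = a * helmholtz_form \<kappa> (\<Omega>s j) (snd u j) (snd w j)"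
      if "u \<in> V" "w \<in> V" for u w a j
      using that subspace_scale[OF fe_sub V_piece]
      by (intro cell_domain.helmholtz_form_scale[OF cell_domain] pieces
          cell_domain.pieces_fe_restr[OF cell_domain])
    show "helmholtz_form \<kappa> (\<Omega>s j) u w = helmholtz_form \<kappa> (\<Omega>s j) w u" for u w j
      by (rule cell_domain.helmholtz_form_commute[OF cell_domain])
  qed (use finitely_spanned_subspace[OF Vf] V_boundary in auto)
  interpret conjugation_positive W conj_multitrace T
  proof
    show "conj_multitrace (conj_multitrace w) = w" for w :: "'n field \<times> ('j \<Rightarrow> 'n field)"
      by (simp add: conj_multitrace_def)
    show "conj_multitrace (0 :: 'n field \<times> ('j \<Rightarrow> 'n field)) = 0"
      by (simp add: conj_multitrace_def zero_prod_def zero_fun_def conj_fun_def)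
  qed (use T Ws in \<open>auto simp: impedance_op_def\<close>)
  let ?X = "fe_restr \<Omega> \<T> k (skeleton \<Omega> \<Omega>s)"
  interpret exchange_setting W conj_multitrace T ?X "restr_op \<Omega> \<Omega>s"
  proof
    show "clinear_on ?X W (restr_op \<Omega> \<Omega>s)" unfolding W by (rule restr_op_linear)
    show "\<exists>x'\<in>?X. restr_op \<Omega> \<Omega>s x' = conj_multitrace (restr_op \<Omega> \<Omega>s x)" if "x \<in> ?X" for x
      using fe_restr_conj[OF \<Omega> that] restr_op_conj by blast
  qed (rule fe)
  have Tl: "clinear_on W (cdual W) T" using T unfolding impedance_op_def by blast
  have Ml: "clinear_on V (cdual V) M"
    unfolding M by (rule impedance_problem_op_linear[OF finitely_spanned_subspace[OF Vf] Al Bl Tl])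
  have ker_ran: "(\<forall>u\<in>V. M u = 0 \<longrightarrow> B u = 0) \<and>
      (\<forall>u\<in>V. \<forall>p\<in>cdual W. A u + adjoint_on V B p \<in> M ` V)"
    using ab
  proof (elim disjE conjE)
    note Vs = finitely_spanned_subspace[OF Vf]
    assume bij: "bij_betw M V (cdual V)"
    have "B u = 0" if "u \<in> V" "M u = 0" for u
    proof -
      have "u = 0"
        using bij that subspace_0[OF Vs] clinear_on_zero[OF Ml Vs]
        unfolding bij_betw_def inj_on_def by metis
      then show ?thesis using clinear_on_zero[OF Bl Vs] by simp
    qed
    moreover have "A u + adjoint_on V B p \<in> M ` V" if "u \<in> V" "p \<in> cdual W" for u p
      using bij_betw_imp_surj_on[OF bij] subspace_add[OF subspace_cdual clinear_on_mem[OF Al that(1)]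
          clinear_on_mem[OF adjoint_clinear[OF Bl Vs] that(2)]] by simp
    ultimately show ?thesis by blast
  next
    assume Qconj: "conj_dual conj_fun ` Qh \<subseteq> Qh"
      and dis: "\<forall>v\<in>H12 \<Omega>. \<forall>q\<in>Hm12 \<Omega>.
          Im (boundary_pairing (\<A> (v, q)) (conj_fun v, conj_dual conj_fun q)) \<le> 0"
    \<comment> \<open>The componentwise conjugation of the broken space. Stability of
      \<open>Qh\<close> under conjugation keeps its values in \<open>V\<close>, so that they are
      admissible test vectors.\<close>
    define D where "D v = ((conj_fun (fst (fst v)), conj_dual conj_fun (snd (fst v))), \<lambda>j. conj_fun (snd v j))"
      for v :: "('n field \<times> ('n field \<Rightarrow> complex)) \<times> ('j \<Rightarrow> 'n field)"
    have D_V: "D v \<in> V" if "v \<in> V" for v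
      using that Qconj fe_restr_conj[OF \<Omega>] unfolding V broken_space_def D_def by auto
    have D_D: "D (D v) = v" for v
      by (simp add: D_def conj_dual_def prod_eq_iff)
    have B_D: "B (D v) = conj_multitrace (B v)" for v
      by (simp add: B D_def trace_op_def conj_multitrace_def restr_conj)
    \<comment> \<open>The dissipativity lemma asks for the sign at every point; outside
      \<open>\<Omega>\<close> the wave number is the real constant \<open>k0\<close>, whose square
      is real.\<close>
    have kappa_Im': "Im ((\<kappa> x)\<^sup>2) \<ge> 0" for x
    proof (cases "x \<in> \<Omega>")
      case False
      then have "(\<kappa> x)\<^sup>2 = of_real (k0\<^sup>2)" using kappa_out(2) by simp
      then show ?thesis by (simp del: of_real_power)
    qed (use kappa_Im in blast)
    \<comment> \<open>\<open>A\<close> is block diagonal and \<open>D\<close> acts blockwise, so the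
      sign is checked separately for the boundary operator and for each subdomain.\<close>
    have A_D: "Im (A v (D v)) \<le> 0" if v: "v \<in> V" for v
    proof -
      have "Im (boundary_pairing (\<A> (fst v)) (fst (D v))) \<le> 0"
        using V_boundary[OF v] dis unfolding D_def by (cases "fst v") auto
      moreover have "Im (helmholtz_form \<kappa> (\<Omega>s j) (snd v j) (snd (D v) j)) \<le> 0" for j
        unfolding D_def snd_conv
        by (intro cell_domain.helmholtz_form_dissipative[OF cell_domain] pieces v kappa_Im'
            cell_domain.pieces_fe_restr[OF cell_domain fe_restr_conj[OF \<Omega> V_piece[OF v]]])
      ultimately show ?thesis
        using D_V[OF v] by (simp add: A diag_op_def Im_sum add_nonpos_nonpos sum_nonpos)
    qed
    show ?thesis
      using dissipative_kernel_and_range[where D = D, OF Vf Al Bl D_V D_D B_D A_D M] by blast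
  qed
  have Pl: "clinear_on (cdual W) (cdual W) Pex" unfolding Pex by (rule exchange_op_linear)
  have PP: "\<forall>p\<in>cdual W. Pex (Pex p) = p"
    unfolding Pex using exchange_op_involutive by blast
  have ker: "\<forall>u\<in>V. M u = 0 \<longrightarrow> B u = 0"
    and ran: "\<forall>u\<in>V. \<forall>p\<in>cdual W. A u + Bs p \<in> M ` V"
    using ker_ran unfolding Bs by blast+
  note eqv = scattering_equivalence[OF ip Vf Ws Al Bl Tl Pl PP M Mp S Bs ker ran l]
  have TB: "T (B u) \<in> cdual W" if "u \<in> V" for u
    using clinear_on_mem[OF Tl clinear_on_mem[OF Bl that]] .
  show ?thesis
    unfolding Let_def
  proof (intro conjI ballI impI, goal_cases)
    case (1 u p)
    then show ?case by (intro subspace_diff[OF subspace_cdual] subspace_scale[OF subspace_cdual] TB)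
  next
    case (2 u p)
    then show ?case using eqv(1)[OF 2(1,2)] by blast
  next
    case (3 q)
    then show ?case using eqv(2)[OF 3] by blast
  next
    case (4 q)
    then show ?case
      by (intro subspace_diff[OF subspace_cdual] subspace_scale[OF subspace_cdual] clinear_on_mem[OF Pl])
  next
    case (5 q)
    then show ?case using eqv(2)[OF 5] by blast
  next
    case (6 q)
    then show ?case using eqv(2)[OF 6] by blast
  qed
qed

end
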